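(* For every constant specification $CS$, every set $\Gamma$ of closed formulas and every closed formula $\Phi$ of the language of $\mathit{FOLP}^\Box$: if $\Gamma\not\vdash_{CS}\Phi$, then there exist a Fitting model $\mathcal{M}$ meeting $CS$, a valuation $\nu$ for $\mathcal{M}$ and a world $w$ of $\mathcal{M}$ such that $(\mathcal{M},\nu),w\Vdash\Psi$ for every $\Psi\in\Gamma$ but $(\mathcal{M},\nu),w\not\Vdash\Phi$.
   Context: Language. Fix countably infinite sets $Var$ (individual variables), $JVar$ (justification variables), $JConst$ (justification constants), and infinitely many predicate symbols of each arity. Justification terms: $t ::= p \mid c \mid (t\cdot t)\mid (t+t)\mid\ !t \mid gen_x(t)$ with $p\in JVar$, $c\in JConst$, $x\in Var$ (the $x$ in $gen_x$ is only an index). Formulas: $P(x_1,\dots,x_n)$; $\neg\Phi$, $\Phi\wedge\Psi$, $\Phi\vee\Psi$, $\Phi\to\Psi$, $\Phi\leftrightarrow\Psi$, $\forall x\Phi$, $\exists x\Phi$; and, for every finite $X\subseteq Var$ and term $t$, $\Box_X\Phi$ and $t{:}_X\Phi$. Free/bound occurrences are as usual for first-order constructs; in $\Box_X\Phi$ and $t{:}_X\Phi$ bound occurrences stay bound, a free occurrence of $x$ in $\Phi$ stays free iff $x\in X$ (otherwise it becomes bound), and the variables in $X$ are free; so $FV(\Box_X\Phi)=FV(t{:}_X\Phi)=X$. A formula is closed if it has no free variables. Logic. $\mathit{FOLP}^\Box_0$ has axioms: (A0) classical first-order axioms; for $y\notin FV(\Phi)$: (A1) $t{:}_{X\cup\{y\}}\Phi\to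 t{:}_X\Phi$, (A1$'$) $\Box_{X\cup\{y\}}\Phi\to\Box_X\Phi$; (A2) $t{:}_X\Phi\to t{:}_{X\cup\{y\}}\Phi$, (A2$'$) $\Box_X\Phi\to\Box_{X\cup\{y\}}\Phi$; (A3) $t{:}_X\Phi\to\Phi$, (A3$'$) $\Box_X\Phi\to\Phi$; (A4) $t{:}_X(\Phi\to\Psi)\to(s{:}_X\Phi\to[t\cdot s]{:}_X\Psi)$, (A4$'$) $\Box_X(\Phi\to\Psi)\to(\Box_X\Phi\to\Box_X\Psi)$; (A5) $t{:}_X\Phi\to[t+s]{:}_X\Phi$, $s{:}_X\Phi\to[t+s]{:}_X\Phi$; (A6) $t{:}_X\Phi\to\ !t{:}_Xt{:}_X\Phi$, (A6$'$) $\Box_X\Phi\to\Box_X\Box_X\Phi$; for $x\notin X$: (A7) $t{:}_X\Phi\to gen_x(t){:}_X\forall x\Phi$, (A7$'$) $\Box_X\Phi\to\Box_X\forall x\Phi$; (A8) $t{:}_X\Phi\to\Box_X\Phi$. Rules: modus ponens, generalization ($\vdash\Phi\Rightarrow\vdash\forall x\Phi$), necessitation ($\vdash\Phi\Rightarrow\vdash\Box_\varnothing\Phi$). A constant specification $CS$ is a set of formulas $c{:}_\varnothing\Phi$ with $c\in JConst$ and $\Phi$ an axiom of $\mathit{FOLP}^\Box_0$; $\mathit{FOLP}^\Box_{CS}$ adds $CS$ as axioms. $\Gamma\vdash_{CS}\Phi$: $\Phi$ derivable in $\mathit{FOLP}^\Box_{CS}$ from hypotheses $\Gamma$, with generalization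 only on variables not free in $\Gamma$ and necessitation only applied to axioms of $\mathit{FOLP}^\Box_0$. Valuations. A valuation of an alphabet $X$ in $D$ is a function $f:X\to D$ (finite if $X$ finite). $f\upharpoonright Y$ is the restriction to $Y\cap Dom(f)$; $ext(f,D)$ the set of finite extensions $g\supseteq f$ with $Im(g)\subseteq D$; $f^{x_1,\dots,x_n}_{d_1,\dots,d_n}$ agrees with $f$ except $x_i\mapsto d_i$; $g\circ\sigma$ is $x\mapsto g(\sigma(x))$ for a variable substitution $\sigma$. Fitting model $\mathcal{M}=(W,R,(D_w)_{w\in W},I,\mathcal{E})$: $W\ne\varnothing$; $R$ reflexive and transitive; $D_w\ne\varnothing$ with $wRu\Rightarrow D_w\subseteq D_u$; $D=\bigcup_wD_w$; $I(P,w)\subseteq D_w^n$; $\mathcal{E}(t,\Phi,f)\subseteq W$ for each term $t$, formula $\Phi$, finite valuation $f$ of variables in $D$, satisfying: adequacy ($w\in\mathcal{E}(t,\Phi,f)\Rightarrow Im(f)\subseteq D_w$); substitution (if $\sigma$ replaces distinct $x_1,\dots,x_n\in FV(\Phi)$ by $y_1,\dots,y_n$ then $\mathcal{E}(t,\Phi\sigma,f\upharpoonright FV(\Phi\sigma))=\mathcal{E}(t,\Phi,f\circ\sigma)$); $R$-closure ($wRu$, $w\in\mathcal{E}(t,\Phi,f)\Rightarrow u\in\mathcal{E}(t,\Phi,f)$); extension ($w\in\mathcal{E}(t,\Phi,f)$, $g\in ext(f,D_w)\Rightarrow w\in\mathcal{E}(t,\Phi,g)$); restriction ($\mathcal{E}(t,\Phi,f)\subseteq\mathcal{E}(t,\Phi,f\upharpoonright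 FV(\Phi))$); $\mathcal{E}(t,\Phi\to\Psi,f)\cap\mathcal{E}(s,\Phi,f)\subseteq\mathcal{E}(t\cdot s,\Psi,f)$; $\mathcal{E}(t,\Phi,f)\cup\mathcal{E}(s,\Phi,f)\subseteq\mathcal{E}(t+s,\Phi,f)$; if $w\in\mathcal{E}(t,\Phi,f)$ then $w\in\mathcal{E}(!t,t{:}_X\Phi,g)$ for all $g\in ext(f,D_w)$ and $X$ with $Dom(f)\cap FV(\Phi)\subseteq X\subseteq Dom(g)$; $\mathcal{E}(t,\Phi,f)\subseteq\mathcal{E}(gen_x(t),\forall x\Phi,f)$ for $x\notin Dom(f)\cap FV(\Phi)$. $\mathcal{M}$ meets $CS$ if $c{:}_\varnothing\Phi\in CS$ implies $\mathcal{E}(c,\Phi,\varnothing)=W$. Truth. A valuation for $\mathcal{M}$ is $\nu:Var\to D$. $(\mathcal{M},\nu),w\Vdash P(x_1,\dots,x_n)$ iff $\langle\nu(x_1),\dots,\nu(x_n)\rangle\in I(P,w)$; $\Vdash\neg\Psi$ iff $\nu(FV(\Psi))\subseteq D_w$ and $\not\Vdash\Psi$; $\wedge$ as usual; $\Vdash\forall x\Psi$ iff $(\mathcal{M},\nu^x_a),w\Vdash\Psi$ for all $a\in D_w$ (other connectives and $\exists$ as standard abbreviations); $\Vdash\Box_X\Psi$ iff $\nu(X)\subseteq D_w$ and for all $u$ with $wRu$ and all $d_1,\dots,d_n\in D_u$, $(\mathcal{M},\nu^{y_1,\dots,y_n}_{d_1,\dots,d_n}),u\Vdash\Psi$ where $\{y_1,\dots,y_n\}=FV(\Psi)\setminus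 X$; $\Vdash t{:}_X\Psi$ iff the conditions for $\Box_X\Psi$ hold and $w\in\mathcal{E}(t,\Psi,\nu\upharpoonright(FV(\Psi)\cap X))$.
   Formalization: In the substitution condition on E, σ must be capture-free for Φ, f must be defined on each y_i that σ introduces, and f∘σ is restricted to FV(Φ); read literally for all partial f, the condition forces constant domains when CS is non-empty and the claim fails. *)

theory Defs
  imports Main "HOL-Library.FSet"
begin

section \<open>Language\<close>

type_synonym var = nat
type_synonym jvar = nat
type_synonym jconst = nat
type_synonym pname = nat

datatype jterm =
    JVar jvar
  | JConst jconst
  | App jterm jterm
  | Sum jterm jterm
  | Bang jterm
  | Gen var jterm

text \<open>
  A predicate symbol of arity \<open>n\<close> is a pair of a name and \<open>n\<close>; in \<open>Atom P xs\<close> the arity is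
  \<open>length xs\<close>, so every atom is well formed and there are infinitely many symbols of each arity.
  \<open>Box X A\<close> is \<open>\<box>\<^sub>X A\<close> and \<open>Just t X A\<close> is \<open>t:\<^sub>X A\<close>.
\<close>

datatype fm =
    Atom pname "var list"
  | Neg fm
  | Conj fm fm
  | Disj fm fm
  | Imp fm fm
  | Iff fm fm
  | All var fm
  | Ex var fm
  | Box "var fset" fm
  | Just jterm "var fset" fm

primrec FV :: "fm \<Rightarrow> var set" where
  "FV (Atom P xs) = set xs"
| "FV (Neg A) = FV A"
| "FV (Conj A B) = FV A \<union> FV B"
| "FV (Disj A B) = FV A \<union> FV B"
| "FV (Imp A B) = FV A \<union> FV B"
| "FV (Iff A B) = FV A \<union> FV B"
| "FV (All x A) = FV A - {x}"
| "FV (Ex x A) = FV A - {x}"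
| "FV (Box X A) = fset X"
| "FV (Just t X A) = fset X"

definition closed_fm :: "fm \<Rightarrow> bool" where
  "closed_fm A \<longleftrightarrow> FV A = {}"

text \<open>
  Simultaneous substitution of variables for free occurrences. A free occurrence in \<open>A\<close> of a
  variable outside \<open>X\<close> is bound in \<open>Box X A\<close> and \<open>Just t X A\<close>, hence left alone.
  Bound variables are not renamed; \<open>free_for\<close> says that no capture takes place.
\<close>

primrec subst :: "(var \<Rightarrow> var) \<Rightarrow> fm \<Rightarrow> fm" where
  "subst \<sigma> (Atom P xs) = Atom P (map \<sigma> xs)"
| "subst \<sigma> (Neg A) = Neg (subst \<sigma> A)"
| "subst \<sigma> (Conj A B) = Conj (subst \<sigma> A) (subst \<sigma> B)"
| "subst \<sigma> (Disj A B) = Disj (subst \<sigma> A) (subst \<sigma> B)"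
| "subst \<sigma> (Imp A B) = Imp (subst \<sigma> A) (subst \<sigma> B)"
| "subst \<sigma> (Iff A B) = Iff (subst \<sigma> A) (subst \<sigma> B)"
| "subst \<sigma> (All x A) = All x (subst (\<sigma>(x := x)) A)"
| "subst \<sigma> (Ex x A) = Ex x (subst (\<sigma>(x := x)) A)"
| "subst \<sigma> (Box X A) = Box (\<sigma> |`| X) (subst (\<lambda>x. if x |\<in>| X then \<sigma> x else x) A)"
| "subst \<sigma> (Just t X A) = Just t (\<sigma> |`| X) (subst (\<lambda>x. if x |\<in>| X then \<sigma> x else x) A)"

primrec free_for :: "(var \<Rightarrow> var) \<Rightarrow> fm \<Rightarrow> bool" where
  "free_for \<sigma> (Atom P xs) \<longleftrightarrow> True"
| "free_for \<sigma> (Neg A) \<longleftrightarrow> free_for \<sigma> A"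
| "free_for \<sigma> (Conj A B) \<longleftrightarrow> free_for \<sigma> A \<and> free_for \<sigma> B"
| "free_for \<sigma> (Disj A B) \<longleftrightarrow> free_for \<sigma> A \<and> free_for \<sigma> B"
| "free_for \<sigma> (Imp A B) \<longleftrightarrow> free_for \<sigma> A \<and> free_for \<sigma> B"
| "free_for \<sigma> (Iff A B) \<longleftrightarrow> free_for \<sigma> A \<and> free_for \<sigma> B"
| "free_for \<sigma> (All x A) \<longleftrightarrow> free_for (\<sigma>(x := x)) A \<and> x \<notin> \<sigma> ` (FV A - {x})"
| "free_for \<sigma> (Ex x A) \<longleftrightarrow> free_for (\<sigma>(x := x)) A \<and> x \<notin> \<sigma> ` (FV A - {x})"
| "free_for \<sigma> (Box X A) \<longleftrightarrow>
     free_for (\<lambda>x. if x |\<in>| X then \<sigma> x else x) A \<and> \<sigma> ` fset X \<inter> (FV A - fset X) = {}"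
| "free_for \<sigma> (Just t X A) \<longleftrightarrow>
     free_for (\<lambda>x. if x |\<in>| X then \<sigma> x else x) A \<and> \<sigma> ` fset X \<inter> (FV A - fset X) = {}"


section \<open>Logic\<close>

text \<open>Boolean evaluation, where \<open>b\<close> assigns truth values to the formulas that are not
  propositional compounds.\<close>

primrec beval :: "(fm \<Rightarrow> bool) \<Rightarrow> fm \<Rightarrow> bool" where
  "beval b (Atom P xs) \<longleftrightarrow> b (Atom P xs)"
| "beval b (Neg A) \<longleftrightarrow> \<not> beval b A"
| "beval b (Conj A B) \<longleftrightarrow> beval b A \<and> beval b B"
| "beval b (Disj A B) \<longleftrightarrow> beval b A \<or> beval b B"
| "beval b (Imp A B) \<longleftrightarrow> (beval b A \<longrightarrow> beval b B)"
| "beval b (Iff A B) \<longleftrightarrow> (beval b A \<longleftrightarrow> beval b B)"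
| "beval b (All x A) \<longleftrightarrow> b (All x A)"
| "beval b (Ex x A) \<longleftrightarrow> b (Ex x A)"
| "beval b (Box X A) \<longleftrightarrow> b (Box X A)"
| "beval b (Just t X A) \<longleftrightarrow> b (Just t X A)"

definition tautology :: "fm \<Rightarrow> bool" where
  "tautology A \<longleftrightarrow> (\<forall>b. beval b A)"

text \<open>The classical first-order axioms are all propositional tautologies together with the usual
  quantifier axioms for a calculus whose rules are modus ponens and generalization.\<close>

inductive fo_axiom :: "fm \<Rightarrow> bool" where
  Taut: "tautology A \<Longrightarrow> fo_axiom A"
| All_inst: "free_for (id(x := y)) A \<Longrightarrow> fo_axiom (Imp (All x A) (subst (id(x := y)) A))"
| Ex_intro: "free_for (id(x := y)) A \<Longrightarrow> fo_axiom (Imp (subst (id(x := y)) A) (Ex x A))"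
| All_dist: "x \<notin> FV A \<Longrightarrow> fo_axiom (Imp (All x (Imp A B)) (Imp A (All x B)))"
| Ex_dist: "x \<notin> FV B \<Longrightarrow> fo_axiom (Imp (All x (Imp A B)) (Imp (Ex x A) B))"

inductive folp_axiom :: "fm \<Rightarrow> bool" where
  A0: "fo_axiom A \<Longrightarrow> folp_axiom A"
| A1: "y \<notin> FV A \<Longrightarrow> folp_axiom (Imp (Just t (finsert y X) A) (Just t X A))"
| A1': "y \<notin> FV A \<Longrightarrow> folp_axiom (Imp (Box (finsert y X) A) (Box X A))"
| A2: "folp_axiom (Imp (Just t X A) (Just t (finsert y X) A))"
| A2': "folp_axiom (Imp (Box X A) (Box (finsert y X) A))"
| A3: "folp_axiom (Imp (Just t X A) A)"
| A3': "folp_axiom (Imp (Box X A) A)"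
| A4: "folp_axiom (Imp (Just t X (Imp A B)) (Imp (Just s X A) (Just (App t s) X B)))"
| A4': "folp_axiom (Imp (Box X (Imp A B)) (Imp (Box X A) (Box X B)))"
| A5_left: "folp_axiom (Imp (Just t X A) (Just (Sum t s) X A))"
| A5_right: "folp_axiom (Imp (Just s X A) (Just (Sum t s) X A))"
| A6: "folp_axiom (Imp (Just t X A) (Just (Bang t) X (Just t X A)))"
| A6': "folp_axiom (Imp (Box X A) (Box X (Box X A)))"
| A7: "x |\<notin>| X \<Longrightarrow> folp_axiom (Imp (Just t X A) (Just (Gen x t) X (All x A)))"
| A7': "x |\<notin>| X \<Longrightarrow> folp_axiom (Imp (Box X A) (Box X (All x A)))"
| A8: "folp_axiom (Imp (Just t X A) (Box X A))"

definition const_spec :: "fm set \<Rightarrow> bool" where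
  "const_spec CS \<longleftrightarrow> CS \<subseteq> {Just (JConst c) {||} A | c A. folp_axiom A}"

inductive derives :: "fm set \<Rightarrow> fm set \<Rightarrow> fm \<Rightarrow> bool" for CS :: "fm set" and \<Gamma> :: "fm set" where
  Hyp: "A \<in> \<Gamma> \<Longrightarrow> derives CS \<Gamma> A"
| Axiom: "folp_axiom A \<Longrightarrow> derives CS \<Gamma> A"
| ConstSpec: "A \<in> CS \<Longrightarrow> derives CS \<Gamma> A"
| MP: "derives CS \<Gamma> (Imp A B) \<Longrightarrow> derives CS \<Gamma> A \<Longrightarrow> derives CS \<Gamma> B"
| Generalization: "derives CS \<Gamma> A \<Longrightarrow> \<forall>B\<in>\<Gamma>. x \<notin> FV B \<Longrightarrow> derives CS \<Gamma> (All x A)"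
| Necessitation: "folp_axiom A \<Longrightarrow> derives CS \<Gamma> (Box {||} A)"


section \<open>Fitting models\<close>

text \<open>\<open>Intp M P n w\<close> interprets the \<open>n\<close>-ary predicate symbol named \<open>P\<close> at \<open>w\<close>. Partial
  valuations are maps; \<open>Evid M t A f\<close> is only constrained for finite valuations \<open>f\<close> in the
  domain of \<open>M\<close>.\<close>

record ('w, 'd) fmodel =
  Worlds :: "'w set"
  Acc :: "('w \<times> 'w) set"
  Dm :: "'w \<Rightarrow> 'd set"
  Intp :: "pname \<Rightarrow> nat \<Rightarrow> 'w \<Rightarrow> 'd list set"
  Evid :: "jterm \<Rightarrow> fm \<Rightarrow> (var \<rightharpoonup> 'd) \<Rightarrow> 'w set"

definition Domain_of :: "('w, 'd) fmodel \<Rightarrow> 'd set" where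
  "Domain_of M = (\<Union>w\<in>Worlds M. Dm M w)"

definition fin_val :: "'d set \<Rightarrow> (var \<rightharpoonup> 'd) \<Rightarrow> bool" where
  "fin_val D f \<longleftrightarrow> finite (dom f) \<and> ran f \<subseteq> D"

definition ext :: "(var \<rightharpoonup> 'd) \<Rightarrow> 'd set \<Rightarrow> (var \<rightharpoonup> 'd) set" where
  "ext f D = {g. fin_val D g \<and> f \<subseteq>\<^sub>m g}"

definition frame_cond :: "('w, 'd) fmodel \<Rightarrow> bool" where
  "frame_cond M \<longleftrightarrow>
     Worlds M \<noteq> {} \<and>
     Acc M \<subseteq> Worlds M \<times> Worlds M \<and> refl_on (Worlds M) (Acc M) \<and> trans (Acc M) \<and>
     (\<forall>w\<in>Worlds M. Dm M w \<noteq> {}) \<and>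
     (\<forall>w u. (w, u) \<in> Acc M \<longrightarrow> Dm M w \<subseteq> Dm M u) \<and>
     (\<forall>P n. \<forall>w\<in>Worlds M. Intp M P n w \<subseteq> {ds. length ds = n \<and> set ds \<subseteq> Dm M w})"

definition adequacy_cond :: "('w, 'd) fmodel \<Rightarrow> bool" where
  "adequacy_cond M \<longleftrightarrow> (\<forall>t A f. fin_val (Domain_of M) f \<longrightarrow>
     Evid M t A f \<subseteq> {w \<in> Worlds M. ran f \<subseteq> Dm M w})"

text \<open>
  The variables replaced by \<open>\<sigma>\<close> are the \<open>x\<close> with \<open>\<sigma> x \<noteq> x\<close>. The composition of \<open>f\<close> with \<open>\<sigma>\<close> is
  read as a valuation of the free variables of \<open>A\<close>, and it has to be defined on all replaced
  variables. Without the restriction to \<open>FV A\<close>, adequacy would force a constant domain as soon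
  as there is evidence at every world. Without the definedness condition, taking \<open>f\<close> empty would
  validate the implication from \<open>t:\<^sub>\<emptyset> P(x,y)\<close> to \<open>t:\<^sub>\<emptyset> P(z,z)\<close>, which is not derivable.
\<close>

definition substitution_cond :: "('w, 'd) fmodel \<Rightarrow> bool" where
  "substitution_cond M \<longleftrightarrow> (\<forall>t A f \<sigma>. fin_val (Domain_of M) f \<and>
     {x. \<sigma> x \<noteq> x} \<subseteq> FV A \<and> free_for \<sigma> A \<and> \<sigma> ` {x. \<sigma> x \<noteq> x} \<subseteq> dom f \<longrightarrow>
     Evid M t (subst \<sigma> A) (f |` FV (subst \<sigma> A)) = Evid M t A ((f \<circ> \<sigma>) |` FV A))"

definition R_closure_cond :: "('w, 'd) fmodel \<Rightarrow> bool" where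
  "R_closure_cond M \<longleftrightarrow> (\<forall>t A f w u. fin_val (Domain_of M) f \<and>
     (w, u) \<in> Acc M \<and> w \<in> Evid M t A f \<longrightarrow> u \<in> Evid M t A f)"

definition extension_cond :: "('w, 'd) fmodel \<Rightarrow> bool" where
  "extension_cond M \<longleftrightarrow> (\<forall>t A f w g. fin_val (Domain_of M) f \<and>
     w \<in> Evid M t A f \<and> g \<in> ext f (Dm M w) \<longrightarrow> w \<in> Evid M t A g)"

definition restriction_cond :: "('w, 'd) fmodel \<Rightarrow> bool" where
  "restriction_cond M \<longleftrightarrow> (\<forall>t A f. fin_val (Domain_of M) f \<longrightarrow>
     Evid M t A f \<subseteq> Evid M t A (f |` FV A))"

definition app_cond :: "('w, 'd) fmodel \<Rightarrow> bool" where
  "app_cond M \<longleftrightarrow> (\<forall>t s A B f. fin_val (Domain_of M) f \<longrightarrow>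
     Evid M t (Imp A B) f \<inter> Evid M s A f \<subseteq> Evid M (App t s) B f)"

definition sum_cond :: "('w, 'd) fmodel \<Rightarrow> bool" where
  "sum_cond M \<longleftrightarrow> (\<forall>t s A f. fin_val (Domain_of M) f \<longrightarrow>
     Evid M t A f \<union> Evid M s A f \<subseteq> Evid M (Sum t s) A f)"

definition bang_cond :: "('w, 'd) fmodel \<Rightarrow> bool" where
  "bang_cond M \<longleftrightarrow> (\<forall>t A f w g X. fin_val (Domain_of M) f \<and> w \<in> Evid M t A f \<and>
     g \<in> ext f (Dm M w) \<and> dom f \<inter> FV A \<subseteq> fset X \<and> fset X \<subseteq> dom g \<longrightarrow>
     w \<in> Evid M (Bang t) (Just t X A) g)"

definition gen_cond :: "('w, 'd) fmodel \<Rightarrow> bool" where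
  "gen_cond M \<longleftrightarrow> (\<forall>t A f x. fin_val (Domain_of M) f \<and> x \<notin> dom f \<inter> FV A \<longrightarrow>
     Evid M t A f \<subseteq> Evid M (Gen x t) (All x A) f)"

definition fitting_model :: "('w, 'd) fmodel \<Rightarrow> bool" where
  "fitting_model M \<longleftrightarrow>
     frame_cond M \<and> adequacy_cond M \<and> substitution_cond M \<and> R_closure_cond M \<and>
     extension_cond M \<and> restriction_cond M \<and> app_cond M \<and> sum_cond M \<and> bang_cond M \<and>
     gen_cond M"

definition meets :: "('w, 'd) fmodel \<Rightarrow> fm set \<Rightarrow> bool" where
  "meets M CS \<longleftrightarrow>
     (\<forall>c A. Just (JConst c) {||} A \<in> CS \<longrightarrow> Evid M (JConst c) A Map.empty = Worlds M)"

definition valuation :: "('w, 'd) fmodel \<Rightarrow> (var \<Rightarrow> 'd) \<Rightarrow> bool" where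
  "valuation M \<nu> \<longleftrightarrow> range \<nu> \<subseteq> Domain_of M"

text \<open>\<open>variants \<nu> Y D\<close> is the set of valuations obtained from \<open>\<nu>\<close> by changing its values on
  \<open>Y\<close> to arbitrary elements of \<open>D\<close>.\<close>

definition variants :: "(var \<Rightarrow> 'd) \<Rightarrow> var set \<Rightarrow> 'd set \<Rightarrow> (var \<Rightarrow> 'd) set" where
  "variants \<nu> Y D = {\<mu>. (\<forall>y\<in>Y. \<mu> y \<in> D) \<and> (\<forall>x. x \<notin> Y \<longrightarrow> \<mu> x = \<nu> x)}"

primrec sat :: "('w, 'd) fmodel \<Rightarrow> (var \<Rightarrow> 'd) \<Rightarrow> 'w \<Rightarrow> fm \<Rightarrow> bool" where
  "sat M \<nu> w (Atom P xs) \<longleftrightarrow> map \<nu> xs \<in> Intp M P (length xs) w"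
| "sat M \<nu> w (Neg A) \<longleftrightarrow> \<nu> ` FV A \<subseteq> Dm M w \<and> \<not> sat M \<nu> w A"
| "sat M \<nu> w (Conj A B) \<longleftrightarrow> sat M \<nu> w A \<and> sat M \<nu> w B"
| "sat M \<nu> w (Disj A B) \<longleftrightarrow>
     \<nu> ` (FV A \<union> FV B) \<subseteq> Dm M w \<and> (sat M \<nu> w A \<or> sat M \<nu> w B)"
| "sat M \<nu> w (Imp A B) \<longleftrightarrow>
     \<nu> ` (FV A \<union> FV B) \<subseteq> Dm M w \<and> (sat M \<nu> w A \<longrightarrow> sat M \<nu> w B)"
| "sat M \<nu> w (Iff A B) \<longleftrightarrow>
     \<nu> ` (FV A \<union> FV B) \<subseteq> Dm M w \<and> (sat M \<nu> w A \<longleftrightarrow> sat M \<nu> w B)"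
| "sat M \<nu> w (All x A) \<longleftrightarrow> (\<forall>a\<in>Dm M w. sat M (\<nu>(x := a)) w A)"
| "sat M \<nu> w (Ex x A) \<longleftrightarrow>
     \<nu> ` (FV A - {x}) \<subseteq> Dm M w \<and> (\<exists>a\<in>Dm M w. sat M (\<nu>(x := a)) w A)"
| "sat M \<nu> w (Box X A) \<longleftrightarrow>
     \<nu> ` fset X \<subseteq> Dm M w \<and>
     (\<forall>u. (w, u) \<in> Acc M \<longrightarrow> (\<forall>\<mu>\<in>variants \<nu> (FV A - fset X) (Dm M u). sat M \<mu> u A))"
| "sat M \<nu> w (Just t X A) \<longleftrightarrow>
     (\<nu> ` fset X \<subseteq> Dm M w \<and>
      (\<forall>u. (w, u) \<in> Acc M \<longrightarrow> (\<forall>\<mu>\<in>variants \<nu> (FV A - fset X) (Dm M u). sat M \<mu> u A))) \<and>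
     w \<in> Evid M t A ((Some \<circ> \<nu>) |` (FV A \<inter> fset X))"

text \<open>The clauses for the remaining connectives are those of the standard abbreviations.\<close>

lemma sat_abbreviations:
  "sat M \<nu> w (Disj A B) \<longleftrightarrow> sat M \<nu> w (Neg (Conj (Neg A) (Neg B)))"
  "sat M \<nu> w (Imp A B) \<longleftrightarrow> sat M \<nu> w (Neg (Conj A (Neg B)))"
  "sat M \<nu> w (Iff A B) \<longleftrightarrow> sat M \<nu> w (Conj (Imp A B) (Imp B A))"
  "sat M \<nu> w (Ex x A) \<longleftrightarrow> sat M \<nu> w (Neg (All x (Neg A)))"
  by (auto simp: image_subset_iff)

end

theory Submission
  imports Defs "HOL-Library.Countable" "HOL-Library.Infinite_Set"
begin

text \<open>
  A canonical model. There is no alpha-conversion under a justification term, so bound variables and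
  domain elements must be kept apart: the original formulas are embedded with every variable \<open>x\<close>
  replaced by \<open>2x\<close>, and odd variables serve as witnesses. Derivability is reflected by this
  embedding because a derivation uses finitely many members of \<open>CS\<close>, whose variables can be
  halved again by an injective renaming.

  Worlds are maximal consistent Henkin sets whose free variables are odd, with infinitely many odd
  variables left over; their free variables form the domain. A world accesses another if its domain
  and its boxed formulas are preserved. A world is in the evidence set of \<open>t\<close>, \<open>A\<close>, \<open>f\<close> if it contains
  \<open>t:\<^sub>Y A\<close> with the free variables of \<open>A\<close> valued by \<open>f\<close> and \<open>Y\<close> the set of their values. The extension
  condition holds because (A2) does not require the new variable to be absent from the formula.
\<close>

section \<open>Renaming of variables\<close>

text \<open>Domain elements are themselves variables, and the truth clauses put them into formulas.
  With a single stock of variables such an element could be captured by a binder, and inside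
  \<open>Just\<close> no equivalent formula with other bound variables is at hand. With even binders
  and odd values no formula has to be inspected: \<open>capture_free\<close> depends on the two maps
  only and, for an injective renaming of binders, survives every binder. A truth clause for a
  modality quantifies over the free variables outside the index set, where the syntax has no
  quantifier. (A7') supplies one: these variables are universally closed inside the box, and (A3')
  then removes the box. Justification formulas need no existence argument of their own: by (A8) the
  box half of their truth clause follows, and the other half is membership in the world by the
  choice of evidence. Hypotheses enter only as antecedents of theorems derived from no hypotheses.
  This keeps the restrictions on generalization and necessitation out of the consistency
  argument.\<close>

instance jterm :: countable
  by countable_datatype

instance fm :: countable
  by countable_datatype

primrec ren_term :: "(var \<Rightarrow> var) \<Rightarrow> jterm \<Rightarrow> jterm" where
  "ren_term \<rho> (JVar p) = JVar p"
| "ren_term \<rho> (JConst c) = JConst c"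
| "ren_term \<rho> (App t s) = App (ren_term \<rho> t) (ren_term \<rho> s)"
| "ren_term \<rho> (Sum t s) = Sum (ren_term \<rho> t) (ren_term \<rho> s)"
| "ren_term \<rho> (Bang t) = Bang (ren_term \<rho> t)"
| "ren_term \<rho> (Gen x t) = Gen (\<rho> x) (ren_term \<rho> t)"

text \<open>The renaming \<open>\<rho>\<close> acts on bound variables, including those bound by a modality and the indices
  of \<open>Gen\<close>; \<open>\<sigma>\<close> acts on free ones.\<close>

primrec ren :: "(var \<Rightarrow> var) \<Rightarrow> (var \<Rightarrow> var) \<Rightarrow> fm \<Rightarrow> fm" where
  "ren \<rho> \<sigma> (Atom P xs) = Atom P (map \<sigma> xs)"
| "ren \<rho> \<sigma> (Neg A) = Neg (ren \<rho> \<sigma> A)"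
| "ren \<rho> \<sigma> (Conj A B) = Conj (ren \<rho> \<sigma> A) (ren \<rho> \<sigma> B)"
| "ren \<rho> \<sigma> (Disj A B) = Disj (ren \<rho> \<sigma> A) (ren \<rho> \<sigma> B)"
| "ren \<rho> \<sigma> (Imp A B) = Imp (ren \<rho> \<sigma> A) (ren \<rho> \<sigma> B)"
| "ren \<rho> \<sigma> (Iff A B) = Iff (ren \<rho> \<sigma> A) (ren \<rho> \<sigma> B)"
| "ren \<rho> \<sigma> (All x A) = All (\<rho> x) (ren \<rho> (\<sigma>(x := \<rho> x)) A)"
| "ren \<rho> \<sigma> (Ex x A) = Ex (\<rho> x) (ren \<rho> (\<sigma>(x := \<rho> x)) A)"
| "ren \<rho> \<sigma> (Box X A) = Box (\<sigma> |`| X) (ren \<rho> (\<lambda>x. if x |\<in>| X then \<sigma> x else \<rho> x) A)"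
| "ren \<rho> \<sigma> (Just t X A) =
     Just (ren_term \<rho> t) (\<sigma> |`| X) (ren \<rho> (\<lambda>x. if x |\<in>| X then \<sigma> x else \<rho> x) A)"

text \<open>Demanded for different variables only: below a binder of \<open>x\<close> the free map
  is reset to send \<open>x\<close> to \<open>\<rho> x\<close>, and the result has to remain
  admissible.\<close>

definition capture_free :: "(var \<Rightarrow> var) \<Rightarrow> (var \<Rightarrow> var) \<Rightarrow> bool" where
  "capture_free \<rho> \<sigma> \<longleftrightarrow> (\<forall>x y. x \<noteq> y \<longrightarrow> \<sigma> x \<noteq> \<rho> y)"

lemma capture_freeD: "capture_free \<rho> \<sigma> \<Longrightarrow> x \<noteq> y \<Longrightarrow> \<sigma> x \<noteq> \<rho> y"
  by (simp add: capture_free_def)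

lemma capture_free_inj: "inj \<rho> \<Longrightarrow> capture_free \<rho> \<rho>"
  by (auto simp: capture_free_def inj_def)

lemma capture_free_upd:
  "capture_free \<rho> \<sigma> \<Longrightarrow> inj \<rho> \<Longrightarrow> capture_free \<rho> (\<sigma>(x := \<rho> x))"
  by (auto simp: capture_free_def inj_def)

lemma capture_free_if:
  "capture_free \<rho> \<sigma> \<Longrightarrow> inj \<rho> \<Longrightarrow> capture_free \<rho> (\<lambda>x. if x |\<in>| X then \<sigma> x else \<rho> x)"
  by (auto simp: capture_free_def inj_def)

lemma finite_FV: "finite (FV A)"
  by (induction A) auto

lemma ren_term_id: "ren_term id t = t"
  by (induction t) auto

lemma ren_term_comp: "ren_term \<rho> (ren_term \<rho>' t) = ren_term (\<rho> \<circ> \<rho>') t"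
  by (induction t) auto

lemma ren_cong: "(\<And>x. x \<in> FV A \<Longrightarrow> \<sigma> x = \<tau> x) \<Longrightarrow> ren \<rho> \<sigma> A = ren \<rho> \<tau> A"
proof (induction A arbitrary: \<sigma> \<tau>)
  case (All x A)
  have "ren \<rho> (\<sigma>(x := \<rho> x)) A = ren \<rho> (\<tau>(x := \<rho> x)) A"
    by (rule All.IH) (use All.prems in auto)
  then show ?case by simp
next
  case (Ex x A)
  have "ren \<rho> (\<sigma>(x := \<rho> x)) A = ren \<rho> (\<tau>(x := \<rho> x)) A"
    by (rule Ex.IH) (use Ex.prems in auto)
  then show ?case by simp
next
  case (Box X A)
  have "ren \<rho> (\<lambda>x. if x |\<in>| X then \<sigma> x else \<rho> x) A
      = ren \<rho> (\<lambda>x. if x |\<in>| X then \<tau> x else \<rho> x) A"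
    by (rule Box.IH) (use Box.prems in auto)
  moreover have "\<sigma> |`| X = \<tau> |`| X"
    by (rule fset.map_cong) (use Box.prems in auto)
  ultimately show ?case by simp
next
  case (Just t X A)
  have "ren \<rho> (\<lambda>x. if x |\<in>| X then \<sigma> x else \<rho> x) A
      = ren \<rho> (\<lambda>x. if x |\<in>| X then \<tau> x else \<rho> x) A"
    by (rule Just.IH) (use Just.prems in auto)
  moreover have "\<sigma> |`| X = \<tau> |`| X"
    by (rule fset.map_cong) (use Just.prems in auto)
  ultimately show ?case by simp
next
  case (Conj A B) then show ?case by (metis FV.simps(3) UnCI ren.simps(3))
next
  case (Disj A B) then show ?case by (metis FV.simps(4) UnCI ren.simps(4))
next
  case (Imp A B) then show ?case by (metis FV.simps(5) UnCI ren.simps(5))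
next
  case (Iff A B) then show ?case by (metis FV.simps(6) UnCI ren.simps(6))
next
  case (Neg A) then show ?case by (metis FV.simps(2) ren.simps(2))
qed simp

lemma subst_eq_ren: "subst \<sigma> A = ren id \<sigma> A"
  by (induction A arbitrary: \<sigma>) (simp_all add: ren_term_id cong: if_cong)

lemma ren_id_id: "ren id id A = A"
proof (induction A)
  case (All x A)
  have "id(x := id x) = id" by auto
  with All show ?case by (metis id_apply ren.simps(7))
next
  case (Ex x A)
  have "id(x := id x) = id" by auto
  with Ex show ?case by (metis id_apply ren.simps(8))
next
  case (Box X A)
  have "(\<lambda>x. if x |\<in>| X then id x else id x) = id" by auto
  then show ?case using Box by (simp add: fset.map_id)
next
  case (Just t X A)
  have "(\<lambda>x. if x |\<in>| X then id x else id x) = id" by auto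
  then show ?case using Just by (simp add: ren_term_id fset.map_id)
qed auto

lemma subst_id: "(\<And>x. x \<in> FV A \<Longrightarrow> \<sigma> x = x) \<Longrightarrow> subst \<sigma> A = A"
  using ren_cong[of A \<sigma> id id] by (simp add: subst_eq_ren ren_id_id)

lemma FV_ren:
  assumes "inj \<rho>"
  shows "capture_free \<rho> \<sigma> \<Longrightarrow> FV (ren \<rho> \<sigma> A) = \<sigma> ` FV A"
proof (induction A arbitrary: \<sigma>)
  case (All x A)
  have IH: "FV (ren \<rho> (\<sigma>(x := \<rho> x)) A) = (\<sigma>(x := \<rho> x)) ` FV A"
    by (rule All.IH[OF capture_free_upd[OF All.prems assms]])
  have "\<sigma> z \<noteq> \<rho> x" if "z \<noteq> x" for z
    by (rule capture_freeD[OF All.prems that])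
  then show ?case unfolding ren.simps FV.simps IH
    by (auto split: if_splits)
next
  case (Ex x A)
  have IH: "FV (ren \<rho> (\<sigma>(x := \<rho> x)) A) = (\<sigma>(x := \<rho> x)) ` FV A"
    by (rule Ex.IH[OF capture_free_upd[OF Ex.prems assms]])
  have "\<sigma> z \<noteq> \<rho> x" if "z \<noteq> x" for z
    by (rule capture_freeD[OF Ex.prems that])
  then show ?case unfolding ren.simps FV.simps IH
    by (auto split: if_splits)
qed auto

lemma FV_subst: "free_for \<sigma> A \<Longrightarrow> FV (subst \<sigma> A) = \<sigma> ` FV A"
  by (induction A arbitrary: \<sigma>) auto

text \<open>Without capture a substitution merely redirects free occurrences, so it is absorbed into
  the free map, whatever \<open>\<rho>\<close> and \<open>g\<close> are.\<close>

lemma ren_subst: "free_for \<sigma> A \<Longrightarrow> ren \<rho> g (subst \<sigma> A) = ren \<rho> (\<lambda>x. g (\<sigma> x)) A"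
proof (induction A arbitrary: \<sigma> g)
  case (All x A)
  have ff: "free_for (\<sigma>(x := x)) A" using All.prems by simp
  have "ren \<rho> (g(x := \<rho> x)) (subst (\<sigma>(x := x)) A)
      = ren \<rho> (\<lambda>z. (g(x := \<rho> x)) ((\<sigma>(x := x)) z)) A"
    by (rule All.IH[OF ff])
  also have "\<dots> = ren \<rho> ((\<lambda>z. g (\<sigma> z))(x := \<rho> x)) A"
    by (rule ren_cong) (use All.prems in auto)
  finally show ?case by simp
next
  case (Ex x A)
  have ff: "free_for (\<sigma>(x := x)) A" using Ex.prems by simp
  have "ren \<rho> (g(x := \<rho> x)) (subst (\<sigma>(x := x)) A)
      = ren \<rho> (\<lambda>z. (g(x := \<rho> x)) ((\<sigma>(x := x)) z)) A"
    by (rule Ex.IH[OF ff])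
  also have "\<dots> = ren \<rho> ((\<lambda>z. g (\<sigma> z))(x := \<rho> x)) A"
    by (rule ren_cong) (use Ex.prems in auto)
  finally show ?case by simp
next
  case (Box X A)
  let ?s = "\<lambda>x. if x |\<in>| X then \<sigma> x else x"
  have "ren \<rho> (\<lambda>y. if y |\<in>| \<sigma> |`| X then g y else \<rho> y) (subst ?s A)
      = ren \<rho> (\<lambda>x. if ?s x |\<in>| \<sigma> |`| X then g (?s x) else \<rho> (?s x)) A"
    by (rule Box.IH) (use Box.prems in simp)
  also have "\<dots> = ren \<rho> (\<lambda>x. if x |\<in>| X then g (\<sigma> x) else \<rho> x) A"
    by (rule ren_cong) (use Box.prems in auto)
  finally show ?case by (simp add: fset.map_comp comp_def)
next
  case (Just t X A)
  let ?s = "\<lambda>x. if x |\<in>| X then \<sigma> x else x"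
  have "ren \<rho> (\<lambda>y. if y |\<in>| \<sigma> |`| X then g y else \<rho> y) (subst ?s A)
      = ren \<rho> (\<lambda>x. if ?s x |\<in>| \<sigma> |`| X then g (?s x) else \<rho> (?s x)) A"
    by (rule Just.IH) (use Just.prems in simp)
  also have "\<dots> = ren \<rho> (\<lambda>x. if x |\<in>| X then g (\<sigma> x) else \<rho> x) A"
    by (rule ren_cong) (use Just.prems in auto)
  finally show ?case by (simp add: fset.map_comp comp_def)
qed simp_all

text \<open>Here the substitution acts after the renaming. Resetting \<open>\<tau>\<close> at a
  renamed binder \<open>\<rho> x\<close> affects no other free variable, because
  \<open>\<sigma>\<close> sends none of them there.\<close>

lemma subst_ren:
  assumes "inj \<rho>"
  shows "capture_free \<rho> \<sigma> \<Longrightarrow> subst \<tau> (ren \<rho> \<sigma> A) = ren \<rho> (\<lambda>x. \<tau> (\<sigma> x)) A"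
proof (induction A arbitrary: \<sigma> \<tau>)
  case (All x A)
  have "(\<lambda>z. (\<tau>(\<rho> x := \<rho> x)) ((\<sigma>(x := \<rho> x)) z)) = (\<lambda>z. \<tau> (\<sigma> z))(x := \<rho> x)"
    using capture_freeD[OF All.prems] by auto
  then show ?case
    using All.IH[OF capture_free_upd[OF All.prems assms], of "\<tau>(\<rho> x := \<rho> x)" x]
    by (simp only: subst.simps ren.simps)
next
  case (Ex x A)
  have "(\<lambda>z. (\<tau>(\<rho> x := \<rho> x)) ((\<sigma>(x := \<rho> x)) z)) = (\<lambda>z. \<tau> (\<sigma> z))(x := \<rho> x)"
    using capture_freeD[OF Ex.prems] by auto
  then show ?case
    using Ex.IH[OF capture_free_upd[OF Ex.prems assms], of "\<tau>(\<rho> x := \<rho> x)" x]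
    by (simp only: subst.simps ren.simps)
next
  case (Box X A)
  let ?s = "\<lambda>x. if x |\<in>| X then \<sigma> x else \<rho> x"
  have "(\<lambda>x. if ?s x |\<in>| \<sigma> |`| X then \<tau> (?s x) else ?s x)
      = (\<lambda>x. if x |\<in>| X then \<tau> (\<sigma> x) else \<rho> x)"
  proof -
    have "\<sigma> z \<noteq> \<rho> x" if "z |\<in>| X" "x |\<notin>| X" for x z
      using capture_freeD[OF Box.prems, of z x] that by auto
    then show ?thesis by (auto simp: fun_eq_iff) metis+
  qed
  then show ?case
    using Box.IH[OF capture_free_if[OF Box.prems assms], of "\<lambda>x. if x |\<in>| \<sigma> |`| X then \<tau> x else x" X]
    by (simp only: subst.simps ren.simps fset.map_comp comp_def)
next
  case (Just t X A)
  let ?s = "\<lambda>x. if x |\<in>| X then \<sigma> x else \<rho> x"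
  have "(\<lambda>x. if ?s x |\<in>| \<sigma> |`| X then \<tau> (?s x) else ?s x)
      = (\<lambda>x. if x |\<in>| X then \<tau> (\<sigma> x) else \<rho> x)"
  proof -
    have "\<sigma> z \<noteq> \<rho> x" if "z |\<in>| X" "x |\<notin>| X" for x z
      using capture_freeD[OF Just.prems, of z x] that by auto
    then show ?thesis by (auto simp: fun_eq_iff) metis+
  qed
  then show ?case
    using Just.IH[OF capture_free_if[OF Just.prems assms], of "\<lambda>x. if x |\<in>| \<sigma> |`| X then \<tau> x else x" X]
    by (simp only: subst.simps ren.simps fset.map_comp comp_def)
qed simp_all

lemma free_for_cong: "(\<And>x. x \<in> FV A \<Longrightarrow> \<sigma> x = \<tau> x) \<Longrightarrow> free_for \<sigma> A \<longleftrightarrow> free_for \<tau> A"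
proof (induction A arbitrary: \<sigma> \<tau>)
  case (All x A)
  have "free_for (\<sigma>(x := x)) A \<longleftrightarrow> free_for (\<tau>(x := x)) A"
    by (rule All.IH) (use All.prems in auto)
  moreover have "\<sigma> ` (FV A - {x}) = \<tau> ` (FV A - {x})"
    by (rule image_cong) (use All.prems in auto)
  ultimately show ?case by simp
next
  case (Ex x A)
  have "free_for (\<sigma>(x := x)) A \<longleftrightarrow> free_for (\<tau>(x := x)) A"
    by (rule Ex.IH) (use Ex.prems in auto)
  moreover have "\<sigma> ` (FV A - {x}) = \<tau> ` (FV A - {x})"
    by (rule image_cong) (use Ex.prems in auto)
  ultimately show ?case by simp
next
  case (Box X A)
  have "free_for (\<lambda>x. if x |\<in>| X then \<sigma> x else x) A \<longleftrightarrow>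
      free_for (\<lambda>x. if x |\<in>| X then \<tau> x else x) A"
    by (rule Box.IH) (use Box.prems in auto)
  moreover have "\<sigma> ` fset X = \<tau> ` fset X"
    by (rule image_cong) (use Box.prems in auto)
  ultimately show ?case by simp
next
  case (Just t X A)
  have "free_for (\<lambda>x. if x |\<in>| X then \<sigma> x else x) A \<longleftrightarrow>
      free_for (\<lambda>x. if x |\<in>| X then \<tau> x else x) A"
    by (rule Just.IH) (use Just.prems in auto)
  moreover have "\<sigma> ` fset X = \<tau> ` fset X"
    by (rule image_cong) (use Just.prems in auto)
  ultimately show ?case by simp
next
  case (Conj A B) then show ?case by (metis FV.simps(3) UnCI free_for.simps(3))
next
  case (Disj A B) then show ?case by (metis FV.simps(4) UnCI free_for.simps(4))
next
  case (Imp A B) then show ?case by (metis FV.simps(5) UnCI free_for.simps(5))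
next
  case (Iff A B) then show ?case by (metis FV.simps(6) UnCI free_for.simps(6))
next
  case (Neg A) then show ?case by (metis FV.simps(2) free_for.simps(2))
qed simp

text \<open>Two conditions for two stages: \<open>\<sigma>\<close> keeps free variables apart from
  renamed binders, and the composite still avoids these binders. Odd parameters placed under even
  binders satisfy both.\<close>

lemma free_for_ren:
  assumes "inj \<rho>"
  shows "capture_free \<rho> \<sigma> \<Longrightarrow> capture_free \<rho> (\<lambda>x. \<tau> (\<sigma> x)) \<Longrightarrow> free_for \<tau> (ren \<rho> \<sigma> A)"
proof (induction A arbitrary: \<sigma> \<tau>)
  case (All x A)
  have eq: "(\<lambda>z. (\<tau>(\<rho> x := \<rho> x)) ((\<sigma>(x := \<rho> x)) z)) = (\<lambda>z. \<tau> (\<sigma> z))(x := \<rho> x)"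
    using capture_freeD[OF All.prems(1)] by auto
  have "free_for (\<tau>(\<rho> x := \<rho> x)) (ren \<rho> (\<sigma>(x := \<rho> x)) A)"
    by (rule All.IH) (simp_all only: eq All.prems capture_free_upd assms)
  moreover have "\<rho> x \<notin> \<tau> ` (FV (ren \<rho> (\<sigma>(x := \<rho> x)) A) - {\<rho> x})"
    unfolding FV_ren[OF assms capture_free_upd[OF All.prems(1) assms]]
    using capture_freeD[OF All.prems(2), of _ x] by (auto split: if_splits) metis
  ultimately show ?case by simp
next
  case (Ex x A)
  have eq: "(\<lambda>z. (\<tau>(\<rho> x := \<rho> x)) ((\<sigma>(x := \<rho> x)) z)) = (\<lambda>z. \<tau> (\<sigma> z))(x := \<rho> x)"
    using capture_freeD[OF Ex.prems(1)] by auto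
  have "free_for (\<tau>(\<rho> x := \<rho> x)) (ren \<rho> (\<sigma>(x := \<rho> x)) A)"
    by (rule Ex.IH) (simp_all only: eq Ex.prems capture_free_upd assms)
  moreover have "\<rho> x \<notin> \<tau> ` (FV (ren \<rho> (\<sigma>(x := \<rho> x)) A) - {\<rho> x})"
    unfolding FV_ren[OF assms capture_free_upd[OF Ex.prems(1) assms]]
    using capture_freeD[OF Ex.prems(2), of _ x] by (auto split: if_splits) metis
  ultimately show ?case by simp
next
  case (Box X A)
  let ?s = "\<lambda>x. if x |\<in>| X then \<sigma> x else \<rho> x"
  let ?t = "\<lambda>x. if x |\<in>| \<sigma> |`| X then \<tau> x else x"
  have eq: "(\<lambda>x. ?t (?s x)) = (\<lambda>x. if x |\<in>| X then \<tau> (\<sigma> x) else \<rho> x)"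
  proof -
    have "\<sigma> z \<noteq> \<rho> x" if "z |\<in>| X" "x |\<notin>| X" for x z
      using capture_freeD[OF Box.prems(1), of z x] that by auto
    then show ?thesis by (auto simp: fun_eq_iff) metis+
  qed
  have "free_for ?t (ren \<rho> ?s A)"
    by (rule Box.IH) (simp_all only: eq Box.prems capture_free_if assms)
  moreover have "\<tau> (\<sigma> z) \<noteq> \<rho> y" if "z |\<in>| X" "y |\<notin>| X" for z y
    using capture_freeD[OF Box.prems(2), of z y] that by auto
  then have "\<tau> v \<notin> FV (ren \<rho> ?s A) - fset (\<sigma> |`| X)" if "v |\<in>| \<sigma> |`| X" for v
    unfolding FV_ren[OF assms capture_free_if[OF Box.prems(1) assms]]
    using that by auto
  ultimately show ?case by auto
next
  case (Just t X A)
  let ?s = "\<lambda>x. if x |\<in>| X then \<sigma> x else \<rho> x"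
  let ?t = "\<lambda>x. if x |\<in>| \<sigma> |`| X then \<tau> x else x"
  have eq: "(\<lambda>x. ?t (?s x)) = (\<lambda>x. if x |\<in>| X then \<tau> (\<sigma> x) else \<rho> x)"
  proof -
    have "\<sigma> z \<noteq> \<rho> x" if "z |\<in>| X" "x |\<notin>| X" for x z
      using capture_freeD[OF Just.prems(1), of z x] that by auto
    then show ?thesis by (auto simp: fun_eq_iff) metis+
  qed
  have "free_for ?t (ren \<rho> ?s A)"
    by (rule Just.IH) (simp_all only: eq Just.prems capture_free_if assms)
  moreover have "\<tau> (\<sigma> z) \<noteq> \<rho> y" if "z |\<in>| X" "y |\<notin>| X" for z y
    using capture_freeD[OF Just.prems(2), of z y] that by auto
  then have "\<tau> v \<notin> FV (ren \<rho> ?s A) - fset (\<sigma> |`| X)" if "v |\<in>| \<sigma> |`| X" for v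
    unfolding FV_ren[OF assms capture_free_if[OF Just.prems(1) assms]]
    using that by auto
  ultimately show ?case by auto
qed simp_all

text \<open>Serves to substitute a fresh variable and then return, the composite being the identity
  on free variables.\<close>

lemma free_for_subst:
  "free_for \<sigma> A \<Longrightarrow> free_for (\<lambda>x. \<tau> (\<sigma> x)) A \<Longrightarrow> free_for \<tau> (subst \<sigma> A)"
proof (induction A arbitrary: \<sigma> \<tau>)
  case (All x A)
  have "free_for (\<lambda>z. (\<tau>(x := x)) ((\<sigma>(x := x)) z)) A \<longleftrightarrow> free_for ((\<lambda>z. \<tau> (\<sigma> z))(x := x)) A"
    by (rule free_for_cong) (use All.prems in auto)
  then have "free_for (\<tau>(x := x)) (subst (\<sigma>(x := x)) A)"
    using All.prems by (intro All.IH) (simp_all only: free_for.simps)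
  then show ?case using All.prems by (auto simp: FV_subst)
next
  case (Ex x A)
  have "free_for (\<lambda>z. (\<tau>(x := x)) ((\<sigma>(x := x)) z)) A \<longleftrightarrow> free_for ((\<lambda>z. \<tau> (\<sigma> z))(x := x)) A"
    by (rule free_for_cong) (use Ex.prems in auto)
  then have "free_for (\<tau>(x := x)) (subst (\<sigma>(x := x)) A)"
    using Ex.prems by (intro Ex.IH) (simp_all only: free_for.simps)
  then show ?case using Ex.prems by (auto simp: FV_subst)
next
  case (Box X A)
  let ?s = "\<lambda>x. if x |\<in>| X then \<sigma> x else x"
  let ?t = "\<lambda>x. if x |\<in>| \<sigma> |`| X then \<tau> x else x"
  have "free_for (\<lambda>x. ?t (?s x)) A \<longleftrightarrow> free_for (\<lambda>x. if x |\<in>| X then \<tau> (\<sigma> x) else x) A"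
    by (rule free_for_cong) (use Box.prems in auto)
  then have "free_for ?t (subst ?s A)"
    using Box.prems by (intro Box.IH) (simp_all only: free_for.simps)
  then show ?case using Box.prems by (auto simp: FV_subst)
next
  case (Just t X A)
  let ?s = "\<lambda>x. if x |\<in>| X then \<sigma> x else x"
  let ?t = "\<lambda>x. if x |\<in>| \<sigma> |`| X then \<tau> x else x"
  have "free_for (\<lambda>x. ?t (?s x)) A \<longleftrightarrow> free_for (\<lambda>x. if x |\<in>| X then \<tau> (\<sigma> x) else x) A"
    by (rule free_for_cong) (use Just.prems in auto)
  then have "free_for ?t (subst ?s A)"
    using Just.prems by (intro Just.IH) (simp_all only: free_for.simps)
  then show ?case using Just.prems by (auto simp: FV_subst)
qed simp_all

lemma free_for_id:
  assumes "\<And>x. x \<in> FV A \<Longrightarrow> \<sigma> x = x"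
  shows "free_for \<sigma> A"
proof -
  have "free_for id A"
  proof (induction A)
    case (All x A)
    have "id(x := x) = id" by auto
    with All show ?case by (metis DiffD2 free_for.simps(7) image_id insertI1 id_apply)
  next
    case (Ex x A)
    have "id(x := x) = id" by auto
    with Ex show ?case by (metis DiffD2 free_for.simps(8) image_id insertI1 id_apply)
  next
    case (Box X A)
    have "(\<lambda>x. if x |\<in>| X then id x else x) = id" by auto
    then show ?case using Box by (auto simp only: free_for.simps) auto
  next
    case (Just t X A)
    have "(\<lambda>x. if x |\<in>| X then id x else x) = id" by auto
    then show ?case using Just by (auto simp only: free_for.simps) auto
  qed auto
  then show ?thesis using free_for_cong[of A \<sigma> id] assms by simp
qed

text \<open>Bound occurrences and index sets count as well; the indices of \<open>Gen\<close> inside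
  terms do not, since they bind nothing.\<close>

primrec vars :: "fm \<Rightarrow> var set" where
  "vars (Atom P xs) = set xs"
| "vars (Neg A) = vars A"
| "vars (Conj A B) = vars A \<union> vars B"
| "vars (Disj A B) = vars A \<union> vars B"
| "vars (Imp A B) = vars A \<union> vars B"
| "vars (Iff A B) = vars A \<union> vars B"
| "vars (All x A) = insert x (vars A)"
| "vars (Ex x A) = insert x (vars A)"
| "vars (Box X A) = fset X \<union> vars A"
| "vars (Just t X A) = fset X \<union> vars A"

lemma finite_vars: "finite (vars A)"
  by (induction A) auto

lemma FV_subset_vars: "FV A \<subseteq> vars A"
  by (induction A) auto

lemma free_for_fresh: "(\<And>z. \<sigma> z \<noteq> z \<Longrightarrow> \<sigma> z \<notin> vars A) \<Longrightarrow> free_for \<sigma> A"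
proof (induction A arbitrary: \<sigma>)
  case (All x A)
  have "free_for (\<sigma>(x := x)) A"
    by (rule All.IH) (use All.prems in \<open>auto split: if_splits\<close>)
  moreover have "x \<notin> \<sigma> ` (FV A - {x})"
  proof
    assume "x \<in> \<sigma> ` (FV A - {x})"
    then obtain z where "z \<noteq> x" "\<sigma> z = x" by auto
    then show False using All.prems[of z] by simp
  qed
  ultimately show ?case by simp
next
  case (Ex x A)
  have "free_for (\<sigma>(x := x)) A"
    by (rule Ex.IH) (use Ex.prems in \<open>auto split: if_splits\<close>)
  moreover have "x \<notin> \<sigma> ` (FV A - {x})"
  proof
    assume "x \<in> \<sigma> ` (FV A - {x})"
    then obtain z where "z \<noteq> x" "\<sigma> z = x" by auto
    then show False using Ex.prems[of z] by simp
  qed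
  ultimately show ?case by simp
next
  case (Box X A)
  have "free_for (\<lambda>x. if x |\<in>| X then \<sigma> x else x) A"
    by (rule Box.IH) (use Box.prems in \<open>auto split: if_splits\<close>)
  moreover have "\<sigma> x \<notin> FV A - fset X" if "x |\<in>| X" for x
    using Box.prems[of x] that FV_subset_vars[of A] by (cases "\<sigma> x = x") auto
  ultimately show ?case by auto
next
  case (Just t X A)
  have "free_for (\<lambda>x. if x |\<in>| X then \<sigma> x else x) A"
    by (rule Just.IH) (use Just.prems in \<open>auto split: if_splits\<close>)
  moreover have "\<sigma> x \<notin> FV A - fset X" if "x |\<in>| X" for x
    using Just.prems[of x] that FV_subset_vars[of A] by (cases "\<sigma> x = x") auto
  ultimately show ?case by auto
qed simp_all

section \<open>Renaming of derivations\<close>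

lemma beval_ren: "beval b (ren \<rho> \<sigma> A) = beval (\<lambda>B. b (ren \<rho> \<sigma> B)) A"
  by (induction A) simp_all

lemma tautology_ren: "tautology A \<Longrightarrow> tautology (ren \<rho> \<sigma> A)"
  by (simp add: tautology_def beval_ren)

text \<open>On renamed variables \<open>\<tau>\<close> does what \<open>\<sigma>\<close> does on the
  original ones. As \<open>\<rho>\<close> is injective, a capture after the renaming would already
  be a capture before it.\<close>

lemma free_for_ren_conj:
  assumes "inj \<rho>"
  shows "free_for \<sigma> A \<Longrightarrow> (\<And>x. \<tau> (\<rho> x) = \<rho> (\<sigma> x)) \<Longrightarrow> free_for \<tau> (ren \<rho> \<rho> A)"
proof (induction A arbitrary: \<sigma> \<tau>)
  case (All x A)
  have "free_for (\<tau>(\<rho> x := \<rho> x)) (ren \<rho> \<rho> A)"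
  proof (rule All.IH)
    show "free_for (\<sigma>(x := x)) A" using All.prems(1) by simp
    show "(\<tau>(\<rho> x := \<rho> x)) (\<rho> z) = \<rho> ((\<sigma>(x := x)) z)" for z
      using All.prems(2) assms by (auto dest: injD)
  qed
  moreover have "\<rho> x \<notin> \<tau> ` (\<rho> ` FV A - {\<rho> x})"
    using All.prems by (auto simp: inj_eq[OF assms])
  ultimately show ?case
    using assms by (simp add: FV_ren capture_free_inj)
next
  case (Ex x A)
  have "free_for (\<tau>(\<rho> x := \<rho> x)) (ren \<rho> \<rho> A)"
  proof (rule Ex.IH)
    show "free_for (\<sigma>(x := x)) A" using Ex.prems(1) by simp
    show "(\<tau>(\<rho> x := \<rho> x)) (\<rho> z) = \<rho> ((\<sigma>(x := x)) z)" for z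
      using Ex.prems(2) assms by (auto dest: injD)
  qed
  moreover have "\<rho> x \<notin> \<tau> ` (\<rho> ` FV A - {\<rho> x})"
    using Ex.prems by (auto simp: inj_eq[OF assms])
  ultimately show ?case
    using assms by (simp add: FV_ren capture_free_inj)
next
  case (Box X A)
  have "free_for (\<lambda>x. if x |\<in>| \<rho> |`| X then \<tau> x else x) (ren \<rho> \<rho> A)"
  proof (rule Box.IH)
    show "free_for (\<lambda>x. if x |\<in>| X then \<sigma> x else x) A" using Box.prems(1) by simp
    show "(if \<rho> z |\<in>| \<rho> |`| X then \<tau> (\<rho> z) else \<rho> z)
        = \<rho> (if z |\<in>| X then \<sigma> z else z)" for z
      using Box.prems(2) assms by (auto dest: injD)
  qed
  moreover have "\<tau> ` \<rho> ` fset X \<inter> (\<rho> ` FV A - \<rho> ` fset X) = {}"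
    using Box.prems by (auto simp: inj_eq[OF assms])
  ultimately show ?case
    using assms by (simp add: FV_ren capture_free_inj)
next
  case (Just t X A)
  have "free_for (\<lambda>x. if x |\<in>| \<rho> |`| X then \<tau> x else x) (ren \<rho> \<rho> A)"
  proof (rule Just.IH)
    show "free_for (\<lambda>x. if x |\<in>| X then \<sigma> x else x) A" using Just.prems(1) by simp
    show "(if \<rho> z |\<in>| \<rho> |`| X then \<tau> (\<rho> z) else \<rho> z)
        = \<rho> (if z |\<in>| X then \<sigma> z else z)" for z
      using Just.prems(2) assms by (auto dest: injD)
  qed
  moreover have "\<tau> ` \<rho> ` fset X \<inter> (\<rho> ` FV A - \<rho> ` fset X) = {}"
    using Just.prems by (auto simp: inj_eq[OF assms])
  ultimately show ?case
    using assms by (simp add: FV_ren capture_free_inj)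
next
  case (Conj A B)
  then show ?case by (metis free_for.simps(3) ren.simps(3))
next
  case (Disj A B)
  then show ?case by (metis free_for.simps(4) ren.simps(4))
next
  case (Imp A B)
  then show ?case by (metis free_for.simps(5) ren.simps(5))
next
  case (Iff A B)
  then show ?case by (metis free_for.simps(6) ren.simps(6))
next
  case (Neg A)
  then show ?case by (metis free_for.simps(2) ren.simps(2))
qed simp

lemma ren_subst_var:
  assumes "inj \<rho>" and "free_for (id(x := y)) A"
  shows "ren \<rho> \<rho> (subst (id(x := y)) A) = subst (id(\<rho> x := \<rho> y)) (ren \<rho> \<rho> A)"
    and "free_for (id(\<rho> x := \<rho> y)) (ren \<rho> \<rho> A)"
proof -
  have eq: "(id(\<rho> x := \<rho> y)) (\<rho> z) = \<rho> ((id(x := y)) z)" for z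
    using assms(1) by (auto dest: injD)
  then have "(\<lambda>z. (id(\<rho> x := \<rho> y)) (\<rho> z)) = (\<lambda>z. \<rho> ((id(x := y)) z))"
    by (rule ext[where 'a = var])
  then show "ren \<rho> \<rho> (subst (id(x := y)) A) = subst (id(\<rho> x := \<rho> y)) (ren \<rho> \<rho> A)"
    by (simp only: ren_subst[OF assms(2)] subst_ren[OF assms(1) capture_free_inj[OF assms(1)]])
  show "free_for (id(\<rho> x := \<rho> y)) (ren \<rho> \<rho> A)"
    by (rule free_for_ren_conj[OF assms eq])
qed

lemma fo_axiom_ren:
  assumes "inj \<rho>" "fo_axiom A"
  shows "fo_axiom (ren \<rho> \<rho> A)"
  using assms(2)
proof cases
  case Taut
  then show ?thesis by (simp add: fo_axiom.Taut tautology_ren)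
next
  case (All_inst x y B)
  then show ?thesis
    using ren_subst_var[OF assms(1) All_inst(2)] by (simp add: fo_axiom.All_inst)
next
  case (Ex_intro x y B)
  then show ?thesis
    using ren_subst_var[OF assms(1) Ex_intro(2)] by (simp add: fo_axiom.Ex_intro)
next
  case (All_dist x B C)
  then have "\<rho> x \<notin> FV (ren \<rho> \<rho> B)"
    using assms(1) by (auto simp: FV_ren capture_free_inj dest: injD)
  then show ?thesis using All_dist by (simp add: fo_axiom.All_dist)
next
  case (Ex_dist x C B)
  then have "\<rho> x \<notin> FV (ren \<rho> \<rho> C)"
    using assms(1) by (auto simp: FV_ren capture_free_inj dest: injD)
  then show ?thesis using Ex_dist by (simp add: fo_axiom.Ex_dist)
qed

lemma folp_axiom_ren:
  assumes "inj \<rho>" "folp_axiom A"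
  shows "folp_axiom (ren \<rho> \<rho> A)"
  using assms(2)
proof cases
  case A0
  then show ?thesis using fo_axiom_ren[OF assms(1)] folp_axiom.A0 by blast
next
  case (A1 y B t X)
  then have "\<rho> y \<notin> FV (ren \<rho> \<rho> B)"
    using assms(1) by (auto simp: FV_ren capture_free_inj dest: injD)
  then show ?thesis using A1 by (simp add: folp_axiom.A1)
next
  case (A1' y B X)
  then have "\<rho> y \<notin> FV (ren \<rho> \<rho> B)"
    using assms(1) by (auto simp: FV_ren capture_free_inj dest: injD)
  then show ?thesis using A1' by (simp add: folp_axiom.A1')
next
  case (A7 x X t B)
  then have "\<rho> x |\<notin>| \<rho> |`| X"
    using assms(1) by (auto dest: injD)
  then show ?thesis using A7 by (simp add: folp_axiom.A7)
next
  case (A7' x X B)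
  then have "\<rho> x |\<notin>| \<rho> |`| X"
    using assms(1) by (auto dest: injD)
  then show ?thesis using A7' by (simp add: folp_axiom.A7')
\<comment> \<open>The schemas without side condition, (A2) to (A6') and (A8). Free and bound
  variables are renamed by the same map, so formulas and their copies inside a modality stay
  equal.\<close>
qed (simp_all add: folp_axiom.intros(4-13) folp_axiom.A8)

lemma ren_term_fixed: "\<exists>N. \<forall>\<rho>. (\<forall>x<N. \<rho> x = x) \<longrightarrow> ren_term \<rho> t = t"
proof (induction t)
  case (App t s)
  then obtain N M where "\<forall>\<rho>. (\<forall>x<N. \<rho> x = x) \<longrightarrow> ren_term \<rho> t = t"
    "\<forall>\<rho>. (\<forall>x<M. \<rho> x = x) \<longrightarrow> ren_term \<rho> s = s" by blast
  then show ?case by (intro exI[of _ "max N M"]) simp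
next
  case (Sum t s)
  then obtain N M where "\<forall>\<rho>. (\<forall>x<N. \<rho> x = x) \<longrightarrow> ren_term \<rho> t = t"
    "\<forall>\<rho>. (\<forall>x<M. \<rho> x = x) \<longrightarrow> ren_term \<rho> s = s" by blast
  then show ?case by (intro exI[of _ "max N M"]) simp
next
  case (Gen x t)
  then obtain N where "\<forall>\<rho>. (\<forall>x<N. \<rho> x = x) \<longrightarrow> ren_term \<rho> t = t" by blast
  then show ?case by (intro exI[of _ "max N (Suc x)"]) simp
qed auto

text \<open>Only finitely many variables occur in a formula, including the bound ones and the
  indices of \<open>Gen\<close>; \<open>N\<close> exceeds them all.\<close>

lemma ren_fixed: "\<exists>N. \<forall>\<rho>. (\<forall>x<N. \<rho> x = x) \<longrightarrow> ren \<rho> \<rho> A = A"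
proof -
  have bound: "\<exists>N. \<forall>x\<in>S. x < N" if "finite S" for S :: "nat set"
    using that finite_nat_set_iff_bounded by blast
  have binary: "\<exists>N. \<forall>\<rho>. (\<forall>x<N. \<rho> x = x) \<longrightarrow> ren \<rho> \<rho> A = A \<and> ren \<rho> \<rho> B = B"
    if "\<exists>N. \<forall>\<rho>. (\<forall>x<N. \<rho> x = x) \<longrightarrow> ren \<rho> \<rho> A = A"
      "\<exists>N. \<forall>\<rho>. (\<forall>x<N. \<rho> x = x) \<longrightarrow> ren \<rho> \<rho> B = B" for A B
  proof -
    from that obtain N M where "\<forall>\<rho>. (\<forall>x<N. \<rho> x = x) \<longrightarrow> ren \<rho> \<rho> A = A"
      "\<forall>\<rho>. (\<forall>x<M. \<rho> x = x) \<longrightarrow> ren \<rho> \<rho> B = B" by blast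
    then show ?thesis by (intro exI[of _ "max N M"]) simp
  qed
  show ?thesis
  proof (induction A)
    case (Atom P xs)
    obtain N where "\<forall>x\<in>set xs. x < N" using bound[of "set xs"] by auto
    then show ?case by (intro exI[of _ N]) (simp add: map_idI)
  next
    case (All x A)
    then obtain N where "\<forall>\<rho>. (\<forall>x<N. \<rho> x = x) \<longrightarrow> ren \<rho> \<rho> A = A" by blast
    then show ?case by (intro exI[of _ "max N (Suc x)"]) (simp add: fun_upd_idem)
  next
    case (Ex x A)
    then obtain N where "\<forall>\<rho>. (\<forall>x<N. \<rho> x = x) \<longrightarrow> ren \<rho> \<rho> A = A" by blast
    then show ?case by (intro exI[of _ "max N (Suc x)"]) (simp add: fun_upd_idem)
  next
    case (Box X A)
    then obtain N where N: "\<forall>\<rho>. (\<forall>x<N. \<rho> x = x) \<longrightarrow> ren \<rho> \<rho> A = A" by blast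
    obtain M where M: "\<forall>x\<in>fset X. x < M" using bound[of "fset X"] by auto
    have "\<rho> |`| X = X" if "\<forall>x<M. \<rho> x = x" for \<rho>
      using that M fset.map_cong[of X X \<rho> id] by simp
    then show ?case using N by (intro exI[of _ "max N M"]) simp
  next
    case (Just t X A)
    then obtain N where N: "\<forall>\<rho>. (\<forall>x<N. \<rho> x = x) \<longrightarrow> ren \<rho> \<rho> A = A" by blast
    obtain M where M: "\<forall>x\<in>fset X. x < M" using bound[of "fset X"] by auto
    obtain K where K: "\<forall>\<rho>. (\<forall>x<K. \<rho> x = x) \<longrightarrow> ren_term \<rho> t = t"
      using ren_term_fixed by blast
    have "\<rho> |`| X = X" if "\<forall>x<M. \<rho> x = x" for \<rho>
      using that M fset.map_cong[of X X \<rho> id] by simp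
    then show ?case using N K by (intro exI[of _ "max N (max M K)"]) simp
  qed (use binary in simp_all)
qed

lemma ren_ren: "ren \<rho> \<rho> (ren \<rho>' \<rho>' A) = ren (\<lambda>x. \<rho> (\<rho>' x)) (\<lambda>x. \<rho> (\<rho>' x)) A"
  by (induction A) (simp_all add: ren_term_comp fset.map_comp comp_def fun_upd_idem)

definition dbl :: "var \<Rightarrow> var" where
  "dbl x = 2 * x"

lemma inj_dbl: "inj dbl"
  by (simp add: inj_def dbl_def)

text \<open>A total left inverse of doubling is not injective, so doubling is only undone below \<open>N\<close>.\<close>

definition halve :: "nat \<Rightarrow> var \<Rightarrow> var" where
  "halve N v = (if even v \<and> v < 2 * N then v div 2 else v + N)"

text \<open>Halved numbers lie below \<open>N\<close>, the shift by \<open>N\<close> places all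
  others at \<open>N\<close> or above, and each branch is injective.\<close>

lemma inj_halve: "inj (halve N)"
proof (rule injI)
  fix v w assume "halve N v = halve N w"
  then show "v = w"
    unfolding halve_def by (auto split: if_splits)
qed

lemma halve_dbl: "x < N \<Longrightarrow> halve N (dbl x) = x"
  by (simp add: halve_def dbl_def)

lemma ren_halve_dbl: "\<exists>N. \<forall>n\<ge>N. ren (halve n) (halve n) (ren dbl dbl A) = A"
proof -
  obtain N where "\<forall>\<rho>. (\<forall>x<N. \<rho> x = x) \<longrightarrow> ren \<rho> \<rho> A = A"
    using ren_fixed by blast
  then show ?thesis
    by (intro exI[of _ N]) (simp add: ren_ren halve_dbl)
qed

text \<open>No single \<open>N\<close> serves all of \<open>CS\<close>, whose variables may be
  unbounded, but each derivation has its own. Stating the claim for all \<open>n \<ge> N\<close>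
  lets the premises of modus ponens meet at the maximum.\<close>

lemma derives_ren_dbl:
  assumes "derives (ren dbl dbl ` CS) {} A"
  shows "\<exists>N. \<forall>n\<ge>N. derives CS {} (ren (halve n) (halve n) A)"
  using assms
proof induction
  case (Axiom A)
  then show ?case using folp_axiom_ren[OF inj_halve] derives.Axiom by blast
next
  case (ConstSpec A)
  then obtain B where "A = ren dbl dbl B" "B \<in> CS" by blast
  then show ?case using ren_halve_dbl[of B] derives.ConstSpec by metis
next
  case (MP A B)
  then obtain N M where "\<forall>n\<ge>N. derives CS {} (ren (halve n) (halve n) (Imp A B))"
    "\<forall>n\<ge>M. derives CS {} (ren (halve n) (halve n) A)" by blast
  then show ?case by (intro exI[of _ "max N M"]) (auto intro: derives.MP)
next
  case (Generalization A x)
  then show ?case by (auto intro!: derives.Generalization)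
next
  case (Necessitation A)
  then show ?case
    using folp_axiom_ren[OF inj_halve] by (auto intro!: derives.Necessitation)
qed simp

lemma derives_ren_dblD: "derives (ren dbl dbl ` CS) {} (ren dbl dbl A) \<Longrightarrow> derives CS {} A"
proof -
  assume "derives (ren dbl dbl ` CS) {} (ren dbl dbl A)"
  then obtain N where N: "\<forall>n\<ge>N. derives CS {} (ren (halve n) (halve n) (ren dbl dbl A))"
    using derives_ren_dbl by blast
  obtain M where M: "\<forall>n\<ge>M. ren (halve n) (halve n) (ren dbl dbl A) = A"
    using ren_halve_dbl by blast
  show ?thesis using N[rule_format, of "max N M"] M by simp
qed

lemma const_spec_ren_dbl:
  assumes "const_spec CS"
  shows "const_spec (ren dbl dbl ` CS)"
proof -
  have "\<exists>c A. ren dbl dbl B = Just (JConst c) {||} A \<and> folp_axiom A" if "B \<in> CS" for B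
  proof -
    from assms that obtain c A where "B = Just (JConst c) {||} A" "folp_axiom A"
      unfolding const_spec_def by blast
    then show ?thesis using folp_axiom_ren[OF inj_dbl] by simp
  qed
  then show ?thesis unfolding const_spec_def by blast
qed

section \<open>Consistency and worlds\<close>

definition imps :: "fm list \<Rightarrow> fm \<Rightarrow> fm" where
  "imps L A = foldr Imp L A"

lemma imps_simps [simp]: "imps [] A = A" "imps (B # L) A = Imp B (imps L A)"
  by (simp_all add: imps_def)

lemma beval_imps: "beval b (imps L A) \<longleftrightarrow> ((\<forall>B\<in>set L. beval b B) \<longrightarrow> beval b A)"
  by (induction L) auto

definition falsum :: fm where
  "falsum = Conj (Atom 0 []) (Neg (Atom 0 []))"

lemma beval_falsum [simp]: "\<not> beval b falsum"
  by (simp add: falsum_def)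

section \<open>Theorems and derived rules of the calculus\<close>

locale folp =
  fixes CS :: "fm set"
  assumes CS: "const_spec CS"
begin

abbreviation Th :: "fm \<Rightarrow> bool" where
  "Th A \<equiv> derives CS {} A"

lemma Th_fo: "fo_axiom A \<Longrightarrow> Th A"
  by (simp add: A0 Axiom)

lemma Th_imps_MP: "Th (imps L A) \<Longrightarrow> \<forall>B\<in>set L. Th B \<Longrightarrow> Th A"
  by (induction L) (auto intro: MP)

lemma Th_taut:
  assumes "\<forall>B\<in>set L. Th B" and "\<And>b. \<forall>B\<in>set L. beval b B \<Longrightarrow> beval b A"
  shows "Th A"
proof (rule Th_imps_MP[OF _ assms(1)])
  show "Th (imps L A)"
    using assms(2) by (intro Th_fo Taut) (auto simp: tautology_def beval_imps)
qed

lemma Th_gen: "Th A \<Longrightarrow> Th (All x A)"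
  by (simp add: Generalization)

lemma Th_subst: "Th A \<Longrightarrow> free_for (id(x := y)) A \<Longrightarrow> Th (subst (id(x := y)) A)"
  using MP[OF Th_fo[OF All_inst] Th_gen] .

lemma Th_All_elim: "Th (Imp (All x A) A)"
proof -
  have "free_for (id(x := x)) A" by (rule free_for_id) auto
  moreover have "subst (id(x := x)) A = A" by (rule subst_id) auto
  ultimately show ?thesis using Th_fo[OF All_inst, of x x A] by simp
qed

lemma Th_Ex_intro: "Th (Imp A (Ex x A))"
proof -
  have "free_for (id(x := x)) A" by (rule free_for_id) auto
  moreover have "subst (id(x := x)) A = A" by (rule subst_id) auto
  ultimately show ?thesis using Th_fo[OF Ex_intro, of x x A] by simp
qed

lemma Th_Ex_iff: "Th (Iff (Ex x A) (Neg (All x (Neg A))))"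
proof -
  have "Th (Imp (Neg (Ex x A)) (Neg A))"
    by (rule Th_taut[of "[Imp A (Ex x A)]"]) (auto simp: Th_Ex_intro)
  then have 1: "Th (Imp (Neg (Ex x A)) (All x (Neg A)))"
    by (intro MP[OF Th_fo[OF All_dist] Th_gen]) auto
  have "Th (Imp A (Neg (All x (Neg A))))"
    by (rule Th_taut[of "[Imp (All x (Neg A)) (Neg A)]"]) (auto simp: Th_All_elim)
  then have 2: "Th (Imp (Ex x A) (Neg (All x (Neg A))))"
    by (intro MP[OF Th_fo[OF Ex_dist] Th_gen]) auto
  show ?thesis
    by (rule Th_taut[of "[Imp (Neg (Ex x A)) (All x (Neg A)),
        Imp (Ex x A) (Neg (All x (Neg A)))]"]) (use 1 2 in auto)
qed

lemma Th_imp_trans: "Th (Imp A B) \<Longrightarrow> Th (Imp B C) \<Longrightarrow> Th (Imp A C)"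
  by (rule Th_taut[of "[Imp A B, Imp B C]"]) auto

lemma Th_imp_refl: "Th (Imp A A)"
  by (rule Th_taut[of "[]"]) auto

text \<open>The rule covers axioms only and is extended along the derivation. A member
  \<open>c:B\<close> of \<open>CS\<close> yields \<open>!c:c:B\<close> by (A6) and then its box by
  (A8); modus ponens passes through (A4'), generalization through (A7') with empty index set, and a
  boxed axiom through (A6').\<close>

lemma Th_nec: "Th A \<Longrightarrow> Th (Box {||} A)"
proof (induction rule: derives.induct)
  case (Axiom A)
  then show ?case by (rule Necessitation)
next
  case (ConstSpec A)
  then obtain c B where A: "A = Just (JConst c) {||} B"
    using CS unfolding const_spec_def by blast
  have "Th (Just (Bang (JConst c)) {||} A)"
    unfolding A by (rule MP[OF Axiom[OF A6]]) (use ConstSpec A derives.ConstSpec in blast)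
  then show ?case by (rule MP[OF Axiom[OF A8]])
next
  case (MP A B)
  show ?case by (rule derives.MP[OF derives.MP[OF Axiom[OF A4'] MP.IH(1)] MP.IH(2)])
next
  case (Generalization A x)
  show ?case by (rule derives.MP[OF Axiom[OF A7'] Generalization.IH]) simp
next
  case (Necessitation A)
  show ?case
    by (rule derives.MP[OF Axiom[OF A6']]) (rule derives.Necessitation[OF Necessitation])
qed simp

lemma Th_Box_extend: "Th (Imp (Box Y A) (Box (Y |\<union>| Z) A))"
proof (induction Z)
  case empty
  then show ?case by (simp add: Th_imp_refl)
next
  case (insert z Z)
  then show ?case using Th_imp_trans[OF _ Axiom[OF A2'], of "Box Y A" "Y |\<union>| Z" A z] by simp
qed

lemma Th_Box_restrict: "fset Z \<inter> FV A = {} \<Longrightarrow> Th (Imp (Box (Y |\<union>| Z) A) (Box Y A))"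
proof (induction Z)
  case empty
  then show ?case by (simp add: Th_imp_refl)
next
  case (insert z Z)
  then have "Th (Imp (Box (finsert z (Y |\<union>| Z)) A) (Box (Y |\<union>| Z) A))"
    by (intro Axiom A1') auto
  then show ?case using Th_imp_trans insert by auto
qed

lemma Th_Just_restrict: "fset Z \<inter> FV A = {} \<Longrightarrow> Th (Imp (Just t (Y |\<union>| Z) A) (Just t Y A))"
proof (induction Z)
  case empty
  then show ?case by (simp add: Th_imp_refl)
next
  case (insert z Z)
  then have "Th (Imp (Just t (finsert z (Y |\<union>| Z)) A) (Just t (Y |\<union>| Z) A))"
    by (intro Axiom A1) auto
  then show ?case using Th_imp_trans insert by auto
qed

section \<open>Entailment and consistency of sets of formulas\<close>

text \<open>Finitely many hypotheses become antecedents of a theorem, so open formulas in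
  \<open>S\<close> never restrict a step of the underlying derivation.\<close>

definition entails :: "fm set \<Rightarrow> fm \<Rightarrow> bool" where
  "entails S A \<longleftrightarrow> (\<exists>L. set L \<subseteq> S \<and> Th (imps L A))"

lemma entails_hyp: "A \<in> S \<Longrightarrow> entails S A"
  unfolding entails_def by (rule exI[of _ "[A]"]) (simp add: Th_imp_refl)

lemma entails_Th: "Th A \<Longrightarrow> entails S A"
  unfolding entails_def by (rule exI[of _ "[]"]) simp

lemma entails_taut:
  assumes "\<forall>B\<in>set L. entails S B" and "\<And>b. \<forall>B\<in>set L. beval b B \<Longrightarrow> beval b A"
  shows "entails S A"
proof -
  have "\<exists>K. set K \<subseteq> S \<and> (\<forall>B\<in>set L. Th (imps K B))"
    using assms(1)
  proof (induction L)
    case Nil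
    show ?case by (rule exI[of _ "[]"]) simp
  next
    case (Cons B L)
    then obtain K J where K: "set K \<subseteq> S" "\<forall>B\<in>set L. Th (imps K B)"
      and J: "set J \<subseteq> S" "Th (imps J B)"
      unfolding entails_def by auto
    have "Th (imps (J @ K) C)" if "Th (imps J C) \<or> Th (imps K C)" for C
      using that
    proof
      assume "Th (imps J C)"
      then show ?thesis by (intro Th_taut[of "[imps J C]"]) (auto simp: beval_imps)
    next
      assume "Th (imps K C)"
      then show ?thesis by (intro Th_taut[of "[imps K C]"]) (auto simp: beval_imps)
    qed
    then show ?case using K J by (intro exI[of _ "J @ K"]) auto
  qed
  then obtain K where K: "set K \<subseteq> S" "\<forall>B\<in>set L. Th (imps K B)" by blast
  have "Th (imps K A)"
    by (rule Th_taut[of "map (imps K) L"]) (use K(2) assms(2) in \<open>auto simp: beval_imps\<close>)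
  then show ?thesis using K(1) unfolding entails_def by blast
qed

text \<open>The deduction theorem becomes propositional: all copies of \<open>A\<close> among the
  antecedents merge into the antecedent of \<open>Imp A B\<close>.\<close>

lemma entails_insert: "entails (insert A S) B \<Longrightarrow> entails S (Imp A B)"
proof -
  assume "entails (insert A S) B"
  then obtain L where L: "set L \<subseteq> insert A S" "Th (imps L B)"
    unfolding entails_def by blast
  have "Th (imps (removeAll A L) (Imp A B))"
    by (rule Th_taut[of "[imps L B]"]) (use L(2) in \<open>auto simp: beval_imps\<close>)
  then show ?thesis using L(1) unfolding entails_def by (intro exI[of _ "removeAll A L"]) auto
qed

lemma Th_All_imps:
  "\<forall>B\<in>set L. x \<notin> FV B \<Longrightarrow> Th (Imp (All x (imps L A)) (imps L (All x A)))"
proof (induction L)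
  case Nil
  then show ?case by (simp add: Th_imp_refl)
next
  case (Cons B L)
  then have "Th (Imp (All x (imps L A)) (imps L (All x A)))" by simp
  moreover have "Th (Imp (All x (Imp B (imps L A))) (Imp B (All x (imps L A))))"
    using Cons.prems by (intro Th_fo All_dist) simp
  ultimately show ?case
    by (intro Th_taut[of "[Imp (All x (imps L A)) (imps L (All x A)),
        Imp (All x (Imp B (imps L A))) (Imp B (All x (imps L A)))]"]) auto
qed

lemma entails_gen: "entails S A \<Longrightarrow> \<forall>B\<in>S. x \<notin> FV B \<Longrightarrow> entails S (All x A)"
proof -
  assume "entails S A" and fresh: "\<forall>B\<in>S. x \<notin> FV B"
  then obtain L where L: "set L \<subseteq> S" "Th (imps L A)" unfolding entails_def by blast
  then have "Th (imps L (All x A))"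
    using fresh by (intro MP[OF Th_All_imps Th_gen]) auto
  then show ?thesis using L(1) unfolding entails_def by blast
qed

definition cons :: "fm set \<Rightarrow> bool" where
  "cons S \<longleftrightarrow> \<not> entails S falsum"

lemma not_cons_insert: "\<not> cons (insert A S) \<Longrightarrow> entails S (Neg A)"
  unfolding cons_def
  by (rule entails_taut[of "[Imp A falsum]"]) (auto dest: entails_insert)

lemma consD: "cons S \<Longrightarrow> entails S A \<Longrightarrow> entails S (Neg A) \<Longrightarrow> False"
  unfolding cons_def using entails_taut[of "[A, Neg A]" S falsum] by auto

section \<open>Henkin construction of worlds\<close>

text \<open>The Henkin property is part of being decided: a universal formula is rejected only
  together with a counterexample from \<open>P\<close>. Existential formulas need no clause, being
  equivalent to negated universal ones.\<close>

definition decided :: "var set \<Rightarrow> fm \<Rightarrow> fm set \<Rightarrow> bool" where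
  "decided P A F \<longleftrightarrow> A \<in> F \<or> (Neg A \<in> F \<and>
     (\<forall>x B. A = All x B \<longrightarrow>
        (\<exists>v\<in>P. free_for (id(x := v)) B \<and> Neg (subst (id(x := v)) B) \<in> F)))"

lemma decided_mono: "decided P A F \<Longrightarrow> F \<subseteq> G \<Longrightarrow> decided P A G"
  unfolding decided_def by blast

text \<open>If adding the counterexample were inconsistent, the instance at the fresh
  \<open>v\<close> would be entailed and could be generalized over \<open>v\<close>, hence
  \<open>All x B\<close> would be entailed, against the consistency of its negation.\<close>

lemma cons_witness:
  assumes "cons (insert (Neg (All x B)) S)" and "v \<notin> vars (All x B)"
    and "\<forall>C\<in>S. v \<notin> FV C"
  shows "cons (insert (Neg (subst (id(x := v)) B)) (insert (Neg (All x B)) S))"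
proof (rule ccontr)
  let ?S = "insert (Neg (All x B)) S" and ?B = "subst (id(x := v)) B"
  have v: "v \<notin> vars B" "v \<noteq> x" using assms(2) by auto
  then have "v \<notin> FV B" using FV_subset_vars by blast
  have ff: "free_for (id(x := v)) B"
    by (rule free_for_fresh) (use v in auto)
  have inverse: "(id(v := x)) ((id(x := v)) z) = z" if "z \<in> FV B" for z
    using that \<open>v \<notin> FV B\<close> by auto
  have "free_for (id(v := x)) ?B"
    by (rule free_for_subst[OF ff free_for_id]) (rule inverse)
  \<comment> \<open>Freshness of \<open>v\<close> makes the substitution reversible: instantiating
    \<open>All v ?B\<close> at \<open>x\<close> returns \<open>B\<close> itself.\<close>
  moreover have "subst (id(v := x)) ?B = B"
    unfolding subst_eq_ren[of "id(v := x)"] ren_subst[OF ff]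
    unfolding subst_eq_ren[symmetric] by (rule subst_id) (rule inverse)
  ultimately have inst: "Th (Imp (All v ?B) B)"
    using Th_fo[OF All_inst, of v x ?B] by simp
  have "x \<notin> FV (All v ?B)"
    using v by (auto simp: FV_subst[OF ff])
  then have close: "Th (Imp (All v ?B) (All x B))"
    by (intro MP[OF Th_fo[OF All_dist] Th_gen[OF inst]])
  assume "\<not> cons (insert (Neg ?B) ?S)"
  then have "entails ?S (Neg (Neg ?B))" by (rule not_cons_insert)
  then have "entails ?S ?B" by (intro entails_taut[of "[Neg (Neg ?B)]" _ ?B]) auto
  moreover have "\<forall>C\<in>?S. v \<notin> FV C" using assms(3) \<open>v \<notin> FV B\<close> by auto
  ultimately have "entails ?S (All v ?B)" by (rule entails_gen)
  then have "entails ?S (All x B)"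
    using entails_Th[OF close] by (intro entails_taut[of "[All v ?B, Imp (All v ?B) (All x B)]"]) auto
  then show False using consD[OF assms(1)] entails_hyp by blast
qed

text \<open>One step of the construction. The possibly infinite start \<open>S\<close> avoids the
  reserve \<open>U\<close>, and the part \<open>F\<close> added so far is finite, so
  \<open>U\<close> still contains a fresh witness.\<close>

lemma decide:
  assumes "cons (S \<union> F)" "finite F" "\<forall>B\<in>F. FV B \<subseteq> P"
    and "U \<subseteq> P" "infinite U" "\<forall>B\<in>S. FV B \<inter> U = {}" "FV A \<subseteq> P"
  shows "\<exists>G. F \<subseteq> G \<and> finite G \<and> (\<forall>B\<in>G. FV B \<subseteq> P) \<and> cons (S \<union> G) \<and> decided P A G"
proof (cases "cons (insert A (S \<union> F))")
  case True
  then show ?thesis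
    using assms by (intro exI[of _ "insert A F"]) (auto simp: decided_def)
next
  case False
  then have neg: "entails (S \<union> F) (Neg A)" by (rule not_cons_insert)
  have cons: "cons (insert (Neg A) (S \<union> F))"
  proof (rule ccontr)
    assume "\<not> ?thesis"
    then show False using not_cons_insert consD[OF assms(1) neg] by blast
  qed
  show ?thesis
  proof (cases "\<exists>x B. A = All x B")
    case False
    then show ?thesis
      using assms cons by (intro exI[of _ "insert (Neg A) F"]) (auto simp: decided_def)
  next
    case True
    then obtain x B where A: "A = All x B" by blast
    have "finite ((\<Union>C\<in>F. FV C) \<union> vars A)"
      using assms(2) by (simp add: finite_FV finite_vars)
    then obtain v where v: "v \<in> U" "v \<notin> (\<Union>C\<in>F. FV C)" "v \<notin> vars A"
      using assms(5) by (meson UnCI finite_subset subsetI)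
    have vB: "v \<notin> vars B" using v(3) A by simp
    have ff: "free_for (id(x := v)) B"
      by (rule free_for_fresh) (use vB in auto)
    have "cons (insert (Neg (subst (id(x := v)) B)) (insert (Neg (All x B)) (S \<union> F)))"
      by (rule cons_witness) (use cons A v assms(6) in auto)
    moreover have "FV (subst (id(x := v)) B) \<subseteq> P"
      using assms(4,7) v(1) A by (auto simp: FV_subst[OF ff])
    ultimately show ?thesis
      using assms A v(1) ff
      by (intro exI[of _ "insert (Neg (subst (id(x := v)) B)) (insert (Neg A) F)"])
        (auto simp: decided_def)
  qed
qed

definition params :: "fm set \<Rightarrow> var set" where
  "params w = (\<Union>A\<in>w. FV A)"

text \<open>Infinitely many odd variables are left unused, to serve as witnesses in accessible worlds.\<close>

definition world :: "fm set \<Rightarrow> bool" where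
  "world w \<longleftrightarrow> cons w \<and> (\<forall>A. FV A \<subseteq> params w \<longrightarrow> decided (params w) A w) \<and>
     params w \<noteq> {} \<and> params w \<subseteq> {v. odd v} \<and> infinite ({v. odd v} - params w)"

lemma ex_world:
  assumes "cons S" "\<forall>A\<in>S. FV A \<subseteq> P" "P \<subseteq> {v. odd v}" "infinite ({v. odd v} - P)"
  shows "\<exists>w. world w \<and> S \<subseteq> w \<and> P \<subseteq> params w"
proof -
  obtain U where U: "U \<subseteq> {v. odd v} - P" "infinite U" "infinite ({v. odd v} - P - U)"
  proof -
    obtain U U' where "U \<subseteq> {v. odd v} - P" "U' \<subseteq> {v. odd v} - P" "infinite U" "infinite U'" "U \<inter> U' = {}"
      using infinite_split[OF assms(4)] by blast
    moreover from this have "U' \<subseteq> {v. odd v} - P - U" by blast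
    ultimately show ?thesis using that finite_subset by blast
  qed
  define Q where "Q = P \<union> U"
  let ?ok = "\<lambda>F. finite F \<and> (\<forall>B\<in>F. FV B \<subseteq> Q) \<and> cons (S \<union> F)"
  \<comment> \<open>\<open>from_nat\<close> enumerates all formulas; those with free variables
    outside \<open>Q\<close> are passed over.\<close>
  let ?step = "\<lambda>n F G. F \<subseteq> G \<and> (FV (from_nat n) \<subseteq> Q \<longrightarrow> decided Q (from_nat n) G)"
  have "\<exists>F. \<forall>n. ?ok (F n) \<and> ?step n (F n) (F (Suc n))"
  proof (rule dependent_nat_choice)
    show "\<exists>F. ?ok F" using assms(1) by (intro exI[of _ "{}"]) simp
  next
    fix F n assume F: "?ok F"
    show "\<exists>G. ?ok G \<and> ?step n F G"
    proof (cases "FV (from_nat n :: fm) \<subseteq> Q")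
      case False
      then show ?thesis using F by blast
    next
      case True
      have "\<exists>G. F \<subseteq> G \<and> finite G \<and> (\<forall>B\<in>G. FV B \<subseteq> Q) \<and> cons (S \<union> G) \<and> decided Q (from_nat n) G"
        by (rule decide[where U = U]) (use F True U assms(2) in \<open>auto simp: Q_def\<close>)
      then show ?thesis by blast
    qed
  qed
  then obtain F where F: "\<forall>n. ?ok (F n) \<and> ?step n (F n) (F (Suc n))" by (rule exE)
  have ok: "?ok (F n)" for n using spec[OF F] by (rule conjunct1)
  have step: "?step n (F n) (F (Suc n))" for n using spec[OF F] by (rule conjunct2)
  have mono: "F m \<subseteq> F n" if "m \<le> n" for m n
    by (rule lift_Suc_mono_le[OF _ that]) (rule conjunct1[OF step])
  define w where "w = S \<union> (\<Union>n. F n)"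
  have decided_w: "decided Q A w" if "FV A \<subseteq> Q" for A
  proof (rule decided_mono)
    show "decided Q A (F (Suc (to_nat A)))" using step[of "to_nat A"] that by simp
    show "F (Suc (to_nat A)) \<subseteq> w" by (auto simp: w_def)
  qed
  have params: "params w = Q"
  proof
    show "params w \<subseteq> Q"
      using ok assms(2) unfolding params_def w_def Q_def by blast
    show "Q \<subseteq> params w"
    proof
      fix v assume "v \<in> Q"
      \<comment> \<open>Whichever way this atom is decided, \<open>v\<close> occurs free in
        \<open>w\<close>; so the parameters fill all of \<open>Q\<close>.\<close>
      then have "decided Q (Atom 0 [v]) w" by (intro decided_w) simp
      then show "v \<in> params w" unfolding decided_def params_def by force
    qed
  qed
  have "cons w"
    unfolding cons_def entails_def
  proof
    assume "\<exists>L. set L \<subseteq> w \<and> Th (imps L falsum)"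
    then obtain L where L: "set L \<subseteq> w" "Th (imps L falsum)" by blast
    \<comment> \<open>Compactness: the finite list of antecedents lies in a single stage of the
      increasing chain.\<close>
    have "\<exists>n. set L \<subseteq> S \<union> F n"
      using L(1)
    proof (induction L)
      case (Cons A L)
      then obtain n where n: "set L \<subseteq> S \<union> F n" by auto
      from Cons.prems obtain m where "A \<in> S \<union> F m" unfolding w_def by auto
      then show ?case
        using n mono[of n "max n m"] mono[of m "max n m"] by (intro exI[of _ "max n m"]) auto
    qed simp
    then show False using ok L(2) unfolding cons_def entails_def by blast
  qed
  moreover have "infinite ({v. odd v} - Q)"
  proof -
    have "{v. odd v} - Q = {v. odd v} - P - U" by (auto simp: Q_def)
    then show ?thesis using U(3) by simp
  qed
  moreover have "Q \<noteq> {}" using U(2) by (auto simp: Q_def)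
  moreover have "Q \<subseteq> {v. odd v}" using U(1) assms(3) by (auto simp: Q_def)
  ultimately have "world w"
    unfolding world_def params using decided_w by blast
  then show ?thesis using params unfolding w_def Q_def by blast
qed

end

section \<open>Membership in worlds\<close>

context folp
begin

lemma params_mem: "A \<in> w \<Longrightarrow> FV A \<subseteq> params w"
  unfolding params_def by blast

lemma world_closed:
  assumes "world w" "entails w A" "FV A \<subseteq> params w"
  shows "A \<in> w"
proof (rule ccontr)
  assume "A \<notin> w"
  then have "Neg A \<in> w" using assms(1,3) unfolding world_def decided_def by blast
  then show False using assms consD entails_hyp unfolding world_def by blast
qed

lemma world_Neg: "world w \<Longrightarrow> FV A \<subseteq> params w \<Longrightarrow> Neg A \<in> w \<longleftrightarrow> A \<notin> w"
  using consD entails_hyp unfolding world_def decided_def by blast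

lemma world_taut:
  assumes "world w" "set L \<subseteq> w" "\<And>b. \<forall>B\<in>set L. beval b B \<Longrightarrow> beval b A" "FV A \<subseteq> params w"
  shows "A \<in> w"
  by (rule world_closed[OF assms(1) entails_taut[OF _ assms(3)] assms(4)])
    (use assms(2) entails_hyp in blast)

lemma world_imp: "world w \<Longrightarrow> Th (Imp A B) \<Longrightarrow> A \<in> w \<Longrightarrow> FV B \<subseteq> params w \<Longrightarrow> B \<in> w"
  by (rule world_closed, assumption, rule entails_taut[of "[Imp A B, A]"])
    (simp_all add: entails_Th entails_hyp)

lemma world_MP: "world w \<Longrightarrow> Imp A B \<in> w \<Longrightarrow> A \<in> w \<Longrightarrow> B \<in> w"
  by (rule world_taut[of w "[Imp A B, A]"]) (use params_mem[of "Imp A B" w] in auto)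

lemma world_Conj: "world w \<Longrightarrow> Conj A B \<in> w \<longleftrightarrow> A \<in> w \<and> B \<in> w"
proof -
  assume w: "world w"
  have "A \<in> w" if "Conj A B \<in> w"
    by (rule world_taut[OF w, of "[Conj A B]"]) (use that params_mem[OF that] in auto)
  moreover have "B \<in> w" if "Conj A B \<in> w"
    by (rule world_taut[OF w, of "[Conj A B]"]) (use that params_mem[OF that] in auto)
  moreover have "Conj A B \<in> w" if "A \<in> w" "B \<in> w"
    by (rule world_taut[OF w, of "[A, B]"]) (use that params_mem in auto)
  ultimately show ?thesis by blast
qed

lemma world_connectives:
  assumes w: "world w" and FV: "FV A \<subseteq> params w" "FV B \<subseteq> params w"
  shows "Disj A B \<in> w \<longleftrightarrow> A \<in> w \<or> B \<in> w"
    and "Imp A B \<in> w \<longleftrightarrow> (A \<in> w \<longrightarrow> B \<in> w)"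
    and "Iff A B \<in> w \<longleftrightarrow> (A \<in> w \<longleftrightarrow> B \<in> w)"
proof -
  have cases: "(\<forall>C\<in>set L. C \<in> w) \<Longrightarrow> (\<And>b. \<forall>C\<in>set L. beval b C \<Longrightarrow> beval b D) \<Longrightarrow> FV D \<subseteq> FV A \<union> FV B
      \<Longrightarrow> D \<in> w" for L D
    using FV by (intro world_taut[OF w, of L]) auto
  have neg: "A \<notin> w \<Longrightarrow> Neg A \<in> w" "B \<notin> w \<Longrightarrow> Neg B \<in> w"
    using world_Neg[OF w] FV by auto
  have "A \<in> w \<Longrightarrow> Disj A B \<in> w" by (rule cases[of "[A]"]) auto
  moreover have "B \<in> w \<Longrightarrow> Disj A B \<in> w" by (rule cases[of "[B]"]) auto
  moreover have "Disj A B \<in> w \<Longrightarrow> Neg A \<in> w \<Longrightarrow> B \<in> w"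
    by (rule cases[of "[Disj A B, Neg A]"]) auto
  ultimately show "Disj A B \<in> w \<longleftrightarrow> A \<in> w \<or> B \<in> w" using neg by blast
  have "B \<in> w \<Longrightarrow> Imp A B \<in> w" by (rule cases[of "[B]"]) auto
  moreover have "Neg A \<in> w \<Longrightarrow> Imp A B \<in> w" by (rule cases[of "[Neg A]"]) auto
  ultimately show "Imp A B \<in> w \<longleftrightarrow> (A \<in> w \<longrightarrow> B \<in> w)"
    using neg world_MP[OF w] by blast
  have "A \<in> w \<Longrightarrow> B \<in> w \<Longrightarrow> Iff A B \<in> w" by (rule cases[of "[A, B]"]) auto
  moreover have "Neg A \<in> w \<Longrightarrow> Neg B \<in> w \<Longrightarrow> Iff A B \<in> w"
    by (rule cases[of "[Neg A, Neg B]"]) auto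
  moreover have "Iff A B \<in> w \<Longrightarrow> A \<in> w \<Longrightarrow> B \<in> w" by (rule cases[of "[Iff A B, A]"]) auto
  moreover have "Iff A B \<in> w \<Longrightarrow> B \<in> w \<Longrightarrow> A \<in> w" by (rule cases[of "[Iff A B, B]"]) auto
  ultimately show "Iff A B \<in> w \<longleftrightarrow> (A \<in> w \<longleftrightarrow> B \<in> w)" using neg by blast
qed

section \<open>Embedded formulas and the quantifiers\<close>

abbreviation emb :: "(var \<Rightarrow> var) \<Rightarrow> fm \<Rightarrow> fm" where
  "emb \<equiv> ren dbl"

abbreviation cf :: "(var \<Rightarrow> var) \<Rightarrow> bool" where
  "cf \<equiv> capture_free dbl"

lemma cf_upd_odd: "cf \<sigma> \<Longrightarrow> odd d \<Longrightarrow> cf (\<sigma>(y := d))"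
  unfolding capture_free_def dbl_def by auto

lemma cf_odd: "(\<And>x. odd (\<sigma> x)) \<Longrightarrow> cf \<sigma>"
  unfolding capture_free_def dbl_def by (metis dvd_triv_left)

lemma FV_emb: "cf \<sigma> \<Longrightarrow> FV (emb \<sigma> A) = \<sigma> ` FV A"
  by (rule FV_ren[OF inj_dbl])

text \<open>Below the quantifier \<open>y\<close> appears as the even \<open>dbl y\<close>.
  Instantiating it by an odd \<open>d\<close> is capture-free, since every binder of an embedded
  formula is even.\<close>

lemma emb_inst:
  assumes "cf \<sigma>" "odd d"
  shows "free_for (id(dbl y := d)) (emb (\<sigma>(y := dbl y)) A)"
    and "subst (id(dbl y := d)) (emb (\<sigma>(y := dbl y)) A) = emb (\<sigma>(y := d)) A"
proof -
  have cf: "cf (\<sigma>(y := dbl y))" by (rule capture_free_upd[OF assms(1) inj_dbl])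
  have eq: "(\<lambda>x. (id(dbl y := d)) ((\<sigma>(y := dbl y)) x)) = \<sigma>(y := d)"
    using capture_freeD[OF assms(1), of _ y] by auto
  show "free_for (id(dbl y := d)) (emb (\<sigma>(y := dbl y)) A)"
    by (rule free_for_ren[OF inj_dbl cf]) (simp only: eq cf_upd_odd[OF assms])
  show "subst (id(dbl y := d)) (emb (\<sigma>(y := dbl y)) A) = emb (\<sigma>(y := d)) A"
    by (simp only: subst_ren[OF inj_dbl cf] eq)
qed

lemma world_odd: "world w \<Longrightarrow> v \<in> params w \<Longrightarrow> odd v"
  unfolding world_def by blast

lemma world_All:
  assumes w: "world w" and cf: "cf \<sigma>"
  shows "emb \<sigma> (All y A) \<in> w \<longleftrightarrow> (\<forall>d\<in>params w. emb (\<sigma>(y := d)) A \<in> w)"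
proof
  assume mem: "emb \<sigma> (All y A) \<in> w"
  show "\<forall>d\<in>params w. emb (\<sigma>(y := d)) A \<in> w"
  proof
    fix d assume d: "d \<in> params w"
    note inst = emb_inst[OF cf world_odd[OF w d], of y A]
    have "Th (Imp (emb \<sigma> (All y A)) (emb (\<sigma>(y := d)) A))"
      using Th_fo[OF All_inst[OF inst(1)]] inst(2) by simp
    moreover have "FV (emb (\<sigma>(y := d)) A) \<subseteq> params w"
      using params_mem[OF mem] d FV_emb[OF cf, of "All y A"]
      unfolding FV_emb[OF cf_upd_odd[OF cf world_odd[OF w d]]] by auto
    ultimately show "emb (\<sigma>(y := d)) A \<in> w" using world_imp[OF w] mem by blast
  qed
next
  assume all: "\<forall>d\<in>params w. emb (\<sigma>(y := d)) A \<in> w"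
  \<comment> \<open>The domain is nonempty, and membership of one instance shows that the universal
    formula has its free variables among the parameters, as decidedness requires.\<close>
  obtain d where d: "d \<in> params w" using w unfolding world_def by blast
  have "FV (emb (\<sigma>(y := d)) A) \<subseteq> params w" using all d params_mem by blast
  then have FV: "FV (emb \<sigma> (All y A)) \<subseteq> params w"
    unfolding FV_emb[OF cf] FV_emb[OF cf_upd_odd[OF cf world_odd[OF w d]]] by auto
  show "emb \<sigma> (All y A) \<in> w"
  proof (rule ccontr)
    assume "emb \<sigma> (All y A) \<notin> w"
    moreover have "decided (params w) (emb \<sigma> (All y A)) w"
      using w FV unfolding world_def by blast
    ultimately obtain v where v: "v \<in> params w"
      "Neg (subst (id(dbl y := v)) (emb (\<sigma>(y := dbl y)) A)) \<in> w"
      unfolding decided_def ren.simps by blast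
    then have "Neg (emb (\<sigma>(y := v)) A) \<in> w"
      using emb_inst(2)[OF cf world_odd[OF w v(1)]] by simp
    then show False using all v(1) world_Neg[OF w] params_mem by blast
  qed
qed

text \<open>Worlds carry witnesses for negated universal formulas only, so the existential case goes
  through \<open>Th_Ex_iff\<close> and \<open>world_All\<close>.\<close>

lemma world_Ex:
  assumes w: "world w" and cf: "cf \<sigma>" and FV: "\<sigma> ` (FV A - {y}) \<subseteq> params w"
  shows "emb \<sigma> (Ex y A) \<in> w \<longleftrightarrow> (\<exists>d\<in>params w. emb (\<sigma>(y := d)) A \<in> w)"
proof -
  have FV_all: "FV (emb \<sigma> (All y (Neg A))) \<subseteq> params w"
    unfolding FV_emb[OF cf] using FV by auto
  have FV_ex: "FV (emb \<sigma> (Ex y A)) \<subseteq> params w"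
    unfolding FV_emb[OF cf] using FV by auto
  have "Iff (emb \<sigma> (Ex y A)) (Neg (emb \<sigma> (All y (Neg A)))) \<in> w"
    by (rule world_closed[OF w entails_Th]) (use Th_Ex_iff FV_all FV_ex in auto)
  then have "emb \<sigma> (Ex y A) \<in> w \<longleftrightarrow> Neg (emb \<sigma> (All y (Neg A))) \<in> w"
    using world_connectives(3)[OF w FV_ex, of "Neg (emb \<sigma> (All y (Neg A)))"] FV_all by auto
  also have "\<dots> \<longleftrightarrow> emb \<sigma> (All y (Neg A)) \<notin> w" by (rule world_Neg[OF w FV_all])
  also have "\<dots> \<longleftrightarrow> \<not> (\<forall>d\<in>params w. Neg (emb (\<sigma>(y := d)) A) \<in> w)"
    using world_All[OF w cf, of y "Neg A"] by simp
  also have "\<dots> \<longleftrightarrow> (\<exists>d\<in>params w. emb (\<sigma>(y := d)) A \<in> w)"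
  proof -
    have "Neg (emb (\<sigma>(y := d)) A) \<in> w \<longleftrightarrow> emb (\<sigma>(y := d)) A \<notin> w" if "d \<in> params w" for d
    proof (rule world_Neg[OF w])
      show "FV (emb (\<sigma>(y := d)) A) \<subseteq> params w"
        unfolding FV_emb[OF cf_upd_odd[OF cf world_odd[OF w that]]] using FV that by auto
    qed
    then show ?thesis by blast
  qed
  finally show ?thesis .
qed

definition alls :: "var list \<Rightarrow> fm \<Rightarrow> fm" where
  "alls ys A = foldr All ys A"

lemma alls_simps [simp]: "alls [] A = A" "alls (y # ys) A = All y (alls ys A)"
  by (simp_all add: alls_def)

lemma FV_alls [simp]: "FV (alls ys A) = FV A - set ys"
  by (induction ys) auto

lemma world_alls:
  assumes w: "world w"
  shows "cf \<sigma> \<Longrightarrow>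
    emb \<sigma> (alls ys A) \<in> w \<longleftrightarrow> (\<forall>\<mu>\<in>variants \<sigma> (set ys) (params w). emb \<mu> A \<in> w)"
proof (induction ys arbitrary: \<sigma>)
  case Nil
  have "variants \<sigma> {} (params w) = {\<sigma>}" by (auto simp: variants_def)
  then show ?case by simp
next
  case (Cons y ys)
  have "emb \<sigma> (alls (y # ys) A) \<in> w \<longleftrightarrow> (\<forall>d\<in>params w. emb (\<sigma>(y := d)) (alls ys A) \<in> w)"
    using world_All[OF w Cons.prems, of y "alls ys A"] by (simp only: alls_simps)
  also have "\<dots> \<longleftrightarrow> (\<forall>d\<in>params w. \<forall>\<mu>\<in>variants (\<sigma>(y := d)) (set ys) (params w). emb \<mu> A \<in> w)"
    using Cons.IH[OF cf_upd_odd[OF Cons.prems world_odd[OF w]]] by blast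
  also have "\<dots> \<longleftrightarrow> (\<forall>\<mu>\<in>variants \<sigma> (set (y # ys)) (params w). emb \<mu> A \<in> w)"
  proof -
    obtain e where e: "e \<in> params w" using w unfolding world_def by blast
    have "(\<Union>d\<in>params w. variants (\<sigma>(y := d)) (set ys) (params w))
        = variants \<sigma> (set (y # ys)) (params w)"
    proof (intro equalityI subsetI)
      fix \<mu> assume "\<mu> \<in> (\<Union>d\<in>params w. variants (\<sigma>(y := d)) (set ys) (params w))"
      then show "\<mu> \<in> variants \<sigma> (set (y # ys)) (params w)"
        unfolding variants_def by (auto split: if_splits)
    next
      fix \<mu> assume mu: "\<mu> \<in> variants \<sigma> (set (y # ys)) (params w)"
      then have "\<mu> \<in> variants (\<sigma>(y := \<mu> y)) (set ys) (params w)" "\<mu> y \<in> params w"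
        unfolding variants_def by auto
      then show "\<mu> \<in> (\<Union>d\<in>params w. variants (\<sigma>(y := d)) (set ys) (params w))" by blast
    qed
    then show ?thesis by blast
  qed
  finally show ?case .
qed

lemma Th_alls_elim:
  "Th (Imp (emb \<sigma> (alls ys A)) (emb (\<lambda>x. if x \<in> set ys then dbl x else \<sigma> x) A))"
proof (induction ys arbitrary: \<sigma>)
  case Nil
  then show ?case by (simp add: Th_imp_refl)
next
  case (Cons y ys)
  have "(\<lambda>x. if x \<in> set ys then dbl x else (\<sigma>(y := dbl y)) x)
      = (\<lambda>x. if x \<in> set (y # ys) then dbl x else \<sigma> x)" by auto
  then have "Th (Imp (emb (\<sigma>(y := dbl y)) (alls ys A))
      (emb (\<lambda>x. if x \<in> set (y # ys) then dbl x else \<sigma> x) A))"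
    using Cons[of "\<sigma>(y := dbl y)"] by (simp only:)
  then show ?case using Th_imp_trans[OF Th_All_elim] by simp
qed

text \<open>The variables \<open>ys\<close> are bound by the modality and so appear as even copies;
  \<open>capture_free\<close> keeps these out of the renamed index set, which is the side condition
  of (A7').\<close>

lemma Th_Box_alls:
  assumes "cf \<sigma>" "set ys \<inter> fset X = {}"
  shows "Th (Imp (emb \<sigma> (Box X A)) (emb \<sigma> (Box X (alls ys A))))"
  using assms(2)
proof (induction ys)
  case Nil
  then show ?case by (simp add: Th_imp_refl)
next
  case (Cons y ys)
  let ?s = "\<lambda>x. if x |\<in>| X then \<sigma> x else dbl x"
  have "dbl y |\<notin>| \<sigma> |`| X"
    using capture_freeD[OF assms(1), of _ y] Cons.prems by force
  moreover have "?s(y := dbl y) = ?s" using Cons.prems by auto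
  ultimately have "Th (Imp (emb \<sigma> (Box X (alls ys A))) (emb \<sigma> (Box X (alls (y # ys) A))))"
    using Axiom[OF A7', of "dbl y" "\<sigma> |`| X" CS "{}" "emb ?s (alls ys A)"]
    by (simp only: ren.simps alls_simps not_False_eq_True)
  then show ?case using Cons Th_imp_trans by auto
qed

section \<open>Accessibility and the box\<close>

definition acc :: "fm set \<Rightarrow> fm set \<Rightarrow> bool" where
  "acc w u \<longleftrightarrow> params w \<subseteq> params u \<and> (\<forall>X A. Box X A \<in> w \<longrightarrow> Box X A \<in> u)"

lemma acc_refl: "acc w w"
  and acc_trans: "acc w u \<Longrightarrow> acc u v \<Longrightarrow> acc w v"
  unfolding acc_def by auto

text \<open>The box is carried to \<open>u\<close>. There (A7') and (A3') produce the universal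
  closure over the variables bound by the modality, and its instances range over the larger domain
  of \<open>u\<close>.\<close>

lemma world_Box_elim:
  assumes w: "world w" and cf: "cf \<sigma>" and "emb \<sigma> (Box X A) \<in> w" "acc w u" "world u"
    and \<mu>: "\<mu> \<in> variants \<sigma> (FV A - fset X) (params u)"
  shows "emb \<mu> A \<in> u"
proof -
  obtain ys where ys: "set ys = FV A - fset X"
    using finite_list[OF finite_Diff[OF finite_FV]] by (rule exE)
  have box: "emb \<sigma> (Box X A) \<in> u" using assms unfolding acc_def by auto
  have FV: "\<sigma> ` fset X \<subseteq> params u" using params_mem[OF box] FV_emb[OF cf, of "Box X A"] by simp
  have "Th (Imp (emb \<sigma> (Box X A)) (emb \<sigma> (Box X (alls ys A))))"
    using ys by (intro Th_Box_alls[OF cf]) auto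
  moreover have "emb (\<lambda>x. if x |\<in>| X then \<sigma> x else dbl x) (alls ys A) = emb \<sigma> (alls ys A)"
    by (rule ren_cong) (use ys in auto)
  then have "Th (Imp (emb \<sigma> (Box X (alls ys A))) (emb \<sigma> (alls ys A)))"
    using Axiom[OF A3', of CS "{}" "\<sigma> |`| X" "emb \<sigma> (alls ys A)"] by simp
  ultimately have "Th (Imp (emb \<sigma> (Box X A)) (emb \<sigma> (alls ys A)))" by (rule Th_imp_trans)
  moreover have "FV (emb \<sigma> (alls ys A)) \<subseteq> params u"
    unfolding FV_emb[OF cf] using FV ys by auto
  ultimately have "emb \<sigma> (alls ys A) \<in> u" using world_imp[OF \<open>world u\<close>] box by blast
  then show ?thesis using world_alls[OF \<open>world u\<close> cf] \<mu> ys by auto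
qed

lemma world_Box_extend: "world w \<Longrightarrow> Box Y A \<in> w \<Longrightarrow> Y |\<subseteq>| Z \<Longrightarrow> fset Z \<subseteq> params w \<Longrightarrow> Box Z A \<in> w"
  using world_imp[OF _ Th_Box_extend[of Y A Z], of w] by (simp only: sup.absorb2 FV.simps)

text \<open>Each antecedent is itself a box: (A6') boxes it once more with its own index set, (A2')
  enlarges that set to \<open>Y\<close>, and (A4') discharges the antecedent.\<close>

lemma world_Box_imps:
  assumes w: "world w" and Y: "fset Y \<subseteq> params w"
  shows "Box Y (imps L D) \<in> w \<Longrightarrow> \<forall>B\<in>set L. B \<in> w \<and> (\<exists>Z C. B = Box Z C \<and> Z |\<subseteq>| Y)
    \<Longrightarrow> Box Y D \<in> w"
proof (induction L)
  case (Cons B L)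
  then obtain Z C where B: "B = Box Z C" "Z |\<subseteq>| Y" "B \<in> w" by auto
  have "Box Z B \<in> w"
    by (rule world_imp[OF w Axiom[OF A6'], of Z C, folded B(1)])
      (use B params_mem[OF B(3)] in auto)
  then have "Box Y B \<in> w" by (rule world_Box_extend[OF w _ B(2) Y])
  moreover have "Imp (Box Y B) (Box Y (imps L D)) \<in> w"
    by (rule world_imp[OF w Axiom[OF A4']]) (use Cons.prems Y in auto)
  ultimately have "Box Y (imps L D) \<in> w" using world_MP[OF w] by blast
  then show ?case using Cons by simp
qed simp

lemma ex_fset: "finite S \<Longrightarrow> \<exists>Y. fset Y = S"
  by (rule exI[of _ "Abs_fset S"]) (simp add: Abs_fset_inverse)

text \<open>The antecedents carry different index sets while (A4') needs one. All steps take place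
  over a common \<open>Y\<close>; afterwards (A1') cuts it down to \<open>Z\<close>, as the surplus
  variables are not free in \<open>D\<close>.\<close>

lemma world_Box_K:
  assumes w: "world w" and Z: "fset Z \<subseteq> params w"
    and L: "\<forall>B\<in>set L. B \<in> w \<and> (\<exists>Y C. B = Box Y C)"
    and "Th (imps L D)" "FV D \<subseteq> fset Z"
  shows "Box Z D \<in> w"
proof -
  have fin: "finite (fset Z \<union> (\<Union>B\<in>set L. FV B))" by (simp add: finite_FV)
  obtain Y where Y: "fset Y = fset Z \<union> (\<Union>B\<in>set L. FV B)"
    using ex_fset[OF fin] by (rule exE)
  have Yw: "fset Y \<subseteq> params w" unfolding Y using Z L params_mem by blast
  have "Box {||} (imps L D) \<in> w"
    by (rule world_closed[OF w entails_Th[OF Th_nec]]) (use assms in auto)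
  then have box: "Box Y (imps L D) \<in> w" by (rule world_Box_extend[OF w _ _ Yw]) simp
  have sub: "U |\<subseteq>| Y" if "Box U C \<in> set L" for U C
    using Y that by (auto simp: less_eq_fset.rep_eq)
  have "B \<in> w \<and> (\<exists>U C. B = Box U C \<and> U |\<subseteq>| Y)" if B: "B \<in> set L" for B
  proof -
    obtain U C where "B = Box U C" using L B by blast
    then show ?thesis using L B sub by simp
  qed
  then have "Box Y D \<in> w"
    by (intro world_Box_imps[OF w Yw box] ballI)
  moreover have "Z |\<union>| (Y |-| Z) = Y"
    using Y by (auto simp: fset_eq_iff)
  moreover have "fset (Y |-| Z) \<inter> FV D = {}" using assms(5) by auto
  ultimately show ?thesis
    using world_imp[OF w Th_Box_restrict[of "Y |-| Z" D Z]] Z by (simp only: FV.simps)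
qed

text \<open>With \<open>D\<close> the universal closure over the variables bound by the modality:
  were \<open>Neg D\<close> consistent with the boxed formulas of \<open>w\<close>, a world
  extending both would be accessible and refute \<open>D\<close>, against the hypothesis. So these
  boxes entail \<open>D\<close>, and \<open>world_Box_K\<close> boxes it.\<close>

lemma world_Box_intro:
  assumes w: "world w" and cf: "cf \<sigma>" and X: "\<sigma> ` fset X \<subseteq> params w"
    and all: "\<And>u \<mu>. world u \<Longrightarrow> acc w u \<Longrightarrow> \<mu> \<in> variants \<sigma> (FV A - fset X) (params u) \<Longrightarrow> emb \<mu> A \<in> u"
  shows "emb \<sigma> (Box X A) \<in> w"
proof -
  obtain ys where ys: "set ys = FV A - fset X"
    using finite_list[OF finite_Diff[OF finite_FV]] by (rule exE)
  let ?D = "emb \<sigma> (alls ys A)" and ?boxes = "{B \<in> w. \<exists>Y C. B = Box Y C}"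
  let ?s = "\<lambda>x. if x |\<in>| X then \<sigma> x else dbl x"
  have FVD: "FV ?D \<subseteq> \<sigma> ` fset X" unfolding FV_emb[OF cf] using ys by auto
  have "\<not> cons (insert (Neg ?D) ?boxes)"
  proof
    assume "cons (insert (Neg ?D) ?boxes)"
    moreover have "\<forall>B\<in>insert (Neg ?D) ?boxes. FV B \<subseteq> params w"
      using params_mem FVD X by auto
    moreover have "params w \<subseteq> {v. odd v}" "infinite ({v. odd v} - params w)"
      using w unfolding world_def by auto
    ultimately obtain u where u: "world u" "insert (Neg ?D) ?boxes \<subseteq> u" "params w \<subseteq> params u"
      using ex_world by meson
    have "acc w u" using u unfolding acc_def by blast
    then have "?D \<in> u" using all u(1) world_alls[OF u(1) cf] ys by simp
    then show False using u world_Neg params_mem by blast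
  qed
  then have "entails ?boxes ?D"
    using not_cons_insert entails_taut[of "[Neg (Neg ?D)]" ?boxes ?D] by auto
  then obtain L where L: "set L \<subseteq> ?boxes" "Th (imps L ?D)" unfolding entails_def by blast
  have box: "Box (\<sigma> |`| X) ?D \<in> w"
    by (rule world_Box_K[OF w _ _ L(2)]) (use L(1) X FVD in auto)
  \<comment> \<open>From the closure back to the body, inside the box: stripping the quantifiers
    leaves the even copies that the modality binds.\<close>
  have "emb (\<lambda>x. if x \<in> set ys then dbl x else \<sigma> x) A = emb ?s A"
    by (rule ren_cong) (use ys in auto)
  then have "Th (Imp ?D (emb ?s A))" using Th_alls_elim[of \<sigma> ys A] by simp
  then have "Box {||} (Imp ?D (emb ?s A)) \<in> w"
    by (intro world_closed[OF w entails_Th[OF Th_nec]]) auto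
  then have "Box (\<sigma> |`| X) (Imp ?D (emb ?s A)) \<in> w"
    by (rule world_Box_extend[OF w]) (use X in auto)
  then have "Imp (Box (\<sigma> |`| X) ?D) (Box (\<sigma> |`| X) (emb ?s A)) \<in> w"
    by (rule world_imp[OF w Axiom[OF A4']]) (use X in auto)
  then show ?thesis using world_MP[OF w] box by simp
qed

lemma world_Box:
  assumes "world w" and "cf \<sigma>"
  shows "emb \<sigma> (Box X A) \<in> w \<longleftrightarrow> \<sigma> ` fset X \<subseteq> params w \<and>
    (\<forall>u. world u \<and> acc w u \<longrightarrow> (\<forall>\<mu>\<in>variants \<sigma> (FV A - fset X) (params u). emb \<mu> A \<in> u))"
  (is "?L \<longleftrightarrow> ?R")
proof
  assume L: ?L
  have "\<sigma> ` fset X \<subseteq> params w" using params_mem[OF L] unfolding FV_emb[OF assms(2)] by simp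
  moreover have "emb \<mu> A \<in> u"
    if "world u \<and> acc w u" "\<mu> \<in> variants \<sigma> (FV A - fset X) (params u)" for u \<mu>
    by (rule world_Box_elim[OF assms L]) (use that in simp_all)
  ultimately show ?R by (intro conjI allI impI ballI)
next
  assume R: ?R
  show ?L by (rule world_Box_intro[OF assms conjunct1[OF R]]) (use conjunct2[OF R] in blast)
qed

section \<open>Index sets of justification formulas in a world\<close>

text \<open>The dropped variables are not free in \<open>A\<close>, so the embedded body does not
  change. As \<open>\<sigma>\<close> may identify variables, what (A1) removes is the difference of
  the images.\<close>

lemma world_Just_restrict:
  assumes w: "world w" and cf: "cf \<sigma>" and "emb \<sigma> (Just t Y A) \<in> w" "X |\<subseteq>| Y"
    and FV: "FV A \<inter> fset Y \<subseteq> fset X"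
  shows "emb \<sigma> (Just t X A) \<in> w"
proof -
  let ?s = "\<lambda>x. if x |\<in>| X then \<sigma> x else dbl x"
  let ?Z = "(\<sigma> |`| Y) |-| (\<sigma> |`| X)"
  have "emb (\<lambda>x. if x |\<in>| Y then \<sigma> x else dbl x) A = emb ?s A"
    by (rule ren_cong) (use FV \<open>X |\<subseteq>| Y\<close> in \<open>auto simp: less_eq_fset.rep_eq\<close>)
  moreover have "\<sigma> |`| X |\<union>| ?Z = \<sigma> |`| Y" using \<open>X |\<subseteq>| Y\<close> by auto
  ultimately have mem: "Just (ren_term dbl t) (\<sigma> |`| X |\<union>| ?Z) (emb ?s A) \<in> w"
    using assms(3) by simp
  \<comment> \<open>A dropped value could be free in the body only as the value of an index in
    \<open>X\<close>, excluded by the difference, or as an even copy, excluded by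
    \<open>capture_free\<close> unless it comes from the dropped variable itself.\<close>
  have "fset ?Z \<inter> FV (emb ?s A) = {}"
  proof -
    have False if "z |\<in>| Y" "\<sigma> z |\<notin>| \<sigma> |`| X" "x \<in> FV A" "\<sigma> z = ?s x" for z x
    proof (cases "x |\<in>| X")
      case True
      then show ?thesis using that by auto
    next
      case False
      then have "z = x" using that capture_freeD[OF cf, of z x] by auto
      then show ?thesis using that False FV by auto
    qed
    then show ?thesis unfolding FV_emb[OF capture_free_if[OF cf inj_dbl]] by fastforce
  qed
  then have "Just (ren_term dbl t) (\<sigma> |`| X) (emb ?s A) \<in> w"
    by (intro world_imp[OF w Th_Just_restrict mem]) (use params_mem[OF mem] in auto)
  then show ?thesis by simp
qed

text \<open>Substitution for a variable bound by the modality: adding \<open>dbl y\<close> to the index set frees it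
  in the conclusion only, so it can be generalized and instantiated there.\<close>

lemma Th_Just_insert:
  assumes cf: "cf \<sigma>" and "odd (\<sigma> y)" "y |\<notin>| X"
  shows "Th (Imp (emb \<sigma> (Just t X A)) (emb \<sigma> (Just t (finsert y X) A)))"
proof -
  let ?r = "\<sigma>(y := dbl y)" and ?B = "Imp (Just t X A) (Just t (finsert y X) A)"
  have "(\<lambda>x. if x |\<in>| finsert y X then ?r x else dbl x) = (\<lambda>x. if x |\<in>| X then ?r x else dbl x)"
    using assms(3) by auto
  then have "Th (emb ?r ?B)"
    using Axiom[OF A2, of CS "{}" "ren_term dbl t" "?r |`| X" "emb (\<lambda>x. if x |\<in>| X then ?r x else dbl x) A" "dbl y"]
    by (simp only: ren.simps) simp
  then have "Th (subst (id(dbl y := \<sigma> y)) (emb ?r ?B))"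
    using emb_inst(1)[OF cf assms(2)] by (rule Th_subst)
  then show ?thesis using emb_inst(2)[OF cf assms(2), of y ?B] by simp
qed

text \<open>The value \<open>\<sigma> z\<close> may already be an index value;
  \<open>Th_Just_insert\<close> needs only that the variable \<open>z\<close> is new.\<close>

lemma world_Just_extend:
  assumes w: "world w" and cf: "cf \<sigma>" and mem: "emb \<sigma> (Just t X A) \<in> w"
  shows "\<sigma> ` fset Z \<subseteq> params w \<Longrightarrow> emb \<sigma> (Just t (X |\<union>| Z) A) \<in> w"
proof (induction Z)
  case empty
  then show ?case using mem by simp
next
  case (insert z Z)
  then have IH: "emb \<sigma> (Just t (X |\<union>| Z) A) \<in> w" by simp
  show ?case
  proof (cases "z |\<in>| X")
    case True
    then have "X |\<union>| finsert z Z = X |\<union>| Z" by auto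
    then show ?thesis using IH by simp
  next
    case False
    have "odd (\<sigma> z)" using insert.prems world_odd[OF w] by simp
    then have "Th (Imp (emb \<sigma> (Just t (X |\<union>| Z) A)) (emb \<sigma> (Just t (finsert z (X |\<union>| Z)) A)))"
      using False insert.hyps by (intro Th_Just_insert[OF cf]) auto
    moreover have "FV (emb \<sigma> (Just t (finsert z (X |\<union>| Z)) A)) \<subseteq> params w"
      using params_mem[OF IH] insert.prems unfolding FV_emb[OF cf] by auto
    ultimately have "emb \<sigma> (Just t (finsert z (X |\<union>| Z)) A) \<in> w"
      using world_imp[OF w] IH by blast
    then show ?thesis by simp
  qed
qed

end

section \<open>The canonical model\<close>

text \<open>Every set of numbers decodes to a set of formulas, so the canonical worlds need no
  well-formedness condition.\<close>

definition decode :: "nat set \<Rightarrow> fm set" where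
  "decode s = {A. to_nat A \<in> s}"

lemma decode_image: "decode (to_nat ` w) = w"
  by (auto simp: decode_def)

text \<open>The default is the even copy that \<open>emb\<close> also gives to bound variables, so
  being undefined amounts to being bound by the modality.\<close>

definition val :: "(var \<rightharpoonup> var) \<Rightarrow> var \<Rightarrow> var" where
  "val f x = (case f x of Some d \<Rightarrow> d | None \<Rightarrow> dbl x)"

lemma val_Some: "f x = Some d \<Longrightarrow> val f x = d"
  and val_None: "x \<notin> dom f \<Longrightarrow> val f x = dbl x"
  by (auto simp: val_def dom_def)

context folp
begin

section \<open>Evidence in the canonical model and its closure conditions\<close>

lemma cf_val:
  assumes "\<And>v. v \<in> ran f \<Longrightarrow> odd v"
  shows "cf (val f)"
  unfolding capture_free_def
proof (intro allI impI)
  fix x y :: var assume "x \<noteq> y"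
  show "val f x \<noteq> dbl y"
  proof (cases "f x")
    case None
    then show ?thesis using \<open>x \<noteq> y\<close> by (simp add: val_def dbl_def)
  next
    case (Some d)
    then have "odd d" using assms by (simp add: ranI)
    then show ?thesis using Some by (auto simp: val_def dbl_def)
  qed
qed

text \<open>A free variable of \<open>A\<close> outside the domain of \<open>f\<close> becomes its even copy, which is bound in the
  justification formula.\<close>

definition evid :: "jterm \<Rightarrow> fm \<Rightarrow> (var \<rightharpoonup> var) \<Rightarrow> fm set \<Rightarrow> bool" where
  "evid t A f w \<longleftrightarrow> ran f \<subseteq> params w \<and>
     (\<exists>Y. fset Y = val f ` (FV A \<inter> dom f) \<and> Just (ren_term dbl t) Y (emb (val f) A) \<in> w)"

text \<open>Inside \<open>Just t X A\<close> the embedding sends variables outside \<open>X\<close>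
  to even copies, exactly as \<open>val f\<close> does outside \<open>dom f\<close>; only one
  \<open>Y\<close> fits.\<close>

lemma evid_iff_emb:
  assumes X: "fset X = FV A \<inter> dom f" and \<sigma>: "\<And>x. x \<in> FV A \<inter> dom f \<Longrightarrow> f x = Some (\<sigma> x)"
  shows "evid t A f w \<longleftrightarrow> ran f \<subseteq> params w \<and> emb \<sigma> (Just t X A) \<in> w"
proof -
  have "\<sigma> ` fset X = val f ` (FV A \<inter> dom f)"
    unfolding X by (rule image_cong[OF refl]) (simp add: val_Some[OF \<sigma>])
  then have "fset Y = val f ` (FV A \<inter> dom f) \<longleftrightarrow> Y = \<sigma> |`| X" for Y
    by (metis fset_inject fimage.rep_eq)
  moreover have "emb (\<lambda>x. if x |\<in>| X then \<sigma> x else dbl x) A = emb (val f) A"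
    by (rule ren_cong) (use X \<sigma> val_Some val_None in auto)
  ultimately show ?thesis unfolding evid_def by simp
qed

text \<open>The index set may differ from \<open>dom f\<close> off the free variables of
  \<open>A\<close>: such indices are added by \<open>world_Just_extend\<close> and removed by
  \<open>world_Just_restrict\<close>. This lets formulas with different free variables share one
  index set.\<close>

lemma evid_iff:
  assumes w: "world w" and cf: "cf \<sigma>" and ran: "ran f \<subseteq> params w"
    and X: "fset X \<inter> FV A = dom f \<inter> FV A" "\<sigma> ` fset X \<subseteq> params w"
    and \<sigma>: "\<And>x. x \<in> FV A \<inter> dom f \<Longrightarrow> f x = Some (\<sigma> x)"
  shows "evid t A f w \<longleftrightarrow> emb \<sigma> (Just t X A) \<in> w"
proof -
  have fin: "finite (FV A \<inter> dom f)" by (simp add: finite_FV)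
  obtain X0 where X0: "fset X0 = FV A \<inter> dom f" using ex_fset[OF fin] by (rule exE)
  have sub: "X0 |\<subseteq>| X" using X(1) X0 by (auto simp: less_eq_fset.rep_eq)
  have "evid t A f w \<longleftrightarrow> emb \<sigma> (Just t X0 A) \<in> w"
    using evid_iff_emb[OF X0 \<sigma>] ran by simp
  also have "\<dots> \<longleftrightarrow> emb \<sigma> (Just t X A) \<in> w"
  proof
    assume "emb \<sigma> (Just t X0 A) \<in> w"
    then have "emb \<sigma> (Just t (X0 |\<union>| X) A) \<in> w"
      by (rule world_Just_extend[OF w cf _ X(2)])
    then show "emb \<sigma> (Just t X A) \<in> w" using sub by (simp only: sup.absorb2)
  next
    assume "emb \<sigma> (Just t X A) \<in> w"
    then show "emb \<sigma> (Just t X0 A) \<in> w"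
      by (rule world_Just_restrict[OF w cf _ sub]) (use X0 X(1) in blast)
  qed
  finally show ?thesis .
qed

lemma evid_val:
  assumes w: "world w" and f: "ran f \<subseteq> params w"
    and X: "fset X \<inter> FV A = dom f \<inter> FV A" "fset X \<subseteq> dom f"
  shows "evid t A f w \<longleftrightarrow> emb (val f) (Just t X A) \<in> w"
proof (rule evid_iff[OF w _ f X(1)])
  show "cf (val f)" by (rule cf_val) (use f world_odd[OF w] in blast)
  show "val f ` fset X \<subseteq> params w"
    using X(2) f by (fastforce simp: val_def ran_def dom_def)
  show "f x = Some (val f x)" if "x \<in> FV A \<inter> dom f" for x
    using that by (auto simp: val_def)
qed

text \<open>Accessibility preserves boxed formulas only, so the justification formula is boxed
  first, through \<open>Bang\<close> by (A6) and then (A8), and unboxed in \<open>u\<close> by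
  (A3').\<close>

lemma evid_acc:
  assumes w: "world w" and u: "world u" and "acc w u" "evid t A f w"
  shows "evid t A f u"
proof -
  obtain Y where Y: "fset Y = val f ` (FV A \<inter> dom f)"
    and mem: "Just (ren_term dbl t) Y (emb (val f) A) \<in> w" (is "?J \<in> w")
    and ran: "ran f \<subseteq> params w"
    using assms(4) unfolding evid_def by blast
  have FV: "fset Y \<subseteq> params w" using params_mem[OF mem] by simp
  have "Just (Bang (ren_term dbl t)) Y ?J \<in> w"
    by (rule world_imp[OF w Axiom[OF A6] mem]) (use FV in simp)
  then have "Box Y ?J \<in> w" by (rule world_imp[OF w Axiom[OF A8]]) (use FV in simp)
  then have "Box Y ?J \<in> u" using assms(3) unfolding acc_def by blast
  then have "?J \<in> u"
    by (rule world_imp[OF u Axiom[OF A3']]) (use FV assms(3) in \<open>auto simp: acc_def\<close>)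
  then show ?thesis using Y ran assms(3) unfolding evid_def acc_def by blast
qed

text \<open>Free variables of \<open>A\<close> that only \<open>g\<close> values were bound by the
  modality; \<open>world_Just_extend\<close> frees them and gives them their values under
  \<open>g\<close>.\<close>

lemma evid_extend:
  assumes w: "world w" and ev: "evid t A f w" and g: "f \<subseteq>\<^sub>m g" "ran g \<subseteq> params w"
  shows "evid t A g w"
proof -
  have fin: "finite (FV A \<inter> dom f)" "finite (FV A \<inter> dom g)" by (simp_all add: finite_FV)
  obtain X where X: "fset X = FV A \<inter> dom f" using ex_fset[OF fin(1)] by (rule exE)
  obtain Z where Z: "fset Z = FV A \<inter> dom g" using ex_fset[OF fin(2)] by (rule exE)
  have vg: "g x = Some (val g x)" if "x \<in> dom g" for x using that by (auto simp: val_def)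
  have dom: "dom f \<subseteq> dom g" and eq: "\<And>x. x \<in> dom f \<Longrightarrow> f x = g x"
    using g(1) by (auto simp: map_le_def dom_def)
  have "f x = Some (val g x)" if "x \<in> FV A \<inter> dom f" for x
    using eq[of x] vg[of x] dom that by auto
  then have "emb (val g) (Just t X A) \<in> w"
    using evid_iff_emb[OF X, of "val g" t w] ev by simp
  moreover have "cf (val g)" by (rule cf_val) (use g(2) world_odd[OF w] in blast)
  moreover have "val g ` fset Z \<subseteq> params w"
    using Z g(2) by (fastforce simp: val_def ran_def dom_def)
  ultimately have "emb (val g) (Just t (X |\<union>| Z) A) \<in> w"
    by (intro world_Just_extend[OF w])
  moreover have "X |\<union>| Z = Z" using X Z dom by (auto simp: fset_eq_iff)
  ultimately show ?thesis using evid_iff_emb[OF Z, of "val g" t w] vg g(2) by simp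
qed

lemma evid_restrict: "evid t A f w \<Longrightarrow> evid t A (f |` FV A) w"
proof -
  assume ev: "evid t A f w"
  have "emb (val (f |` FV A)) A = emb (val f) A"
    by (rule ren_cong) (simp add: val_def)
  moreover have "val (f |` FV A) ` (FV A \<inter> dom (f |` FV A)) = val f ` (FV A \<inter> dom f)"
    by (rule image_cong) (auto simp: val_def)
  moreover have "ran (f |` FV A) \<subseteq> ran f" by (auto simp: ran_def restrict_map_def)
  ultimately show ?thesis using ev unfolding evid_def by auto
qed

lemma evid_app:
  assumes w: "world w" and "evid t (Imp A B) f w" "evid s A f w"
  shows "evid (App t s) B f w"
proof -
  have ran: "ran f \<subseteq> params w" using assms(2) unfolding evid_def by blast
  \<comment> \<open>(A4) asks for one index set in both premises and the conclusion; this one agrees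
    with \<open>dom f\<close> on the free variables of each of the three bodies.\<close>
  have fin: "finite (FV (Imp A B) \<inter> dom f)" by (intro finite_Int disjI1 finite_FV)
  obtain X where X: "fset X = FV (Imp A B) \<inter> dom f" using ex_fset[OF fin] by (rule exE)
  note iff = evid_val[OF w ran, of X]
  have t: "emb (val f) (Just t X (Imp A B)) \<in> w" by (subst iff[symmetric]) (use X assms in auto)
  have s: "emb (val f) (Just s X A) \<in> w" by (subst iff[symmetric]) (use X assms in auto)
  have FV: "FV (emb (val f) (Just s X A)) \<subseteq> params w" by (rule params_mem[OF s])
  have "Imp (emb (val f) (Just s X A)) (emb (val f) (Just (App t s) X B)) \<in> w"
    unfolding ren.simps ren_term.simps
    by (rule world_imp[OF w Axiom[OF A4] t[unfolded ren.simps]]) (use FV in simp)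
  then have "emb (val f) (Just (App t s) X B) \<in> w" using world_MP[OF w] s by blast
  then show ?thesis by (subst iff) (use X in auto)
qed

lemma evid_sum:
  assumes w: "world w" and "evid t A f w \<or> evid s A f w"
  shows "evid (Sum t s) A f w"
proof -
  have "Just (Sum (ren_term dbl t) (ren_term dbl s)) Y B \<in> w"
    if "Just (ren_term dbl t) Y B \<in> w \<or> Just (ren_term dbl s) Y B \<in> w" for Y B
    using that
  proof
    assume m: "Just (ren_term dbl t) Y B \<in> w"
    show ?thesis by (rule world_imp[OF w Axiom[OF A5_left] m]) (use params_mem[OF m] in simp)
  next
    assume m: "Just (ren_term dbl s) Y B \<in> w"
    show ?thesis by (rule world_imp[OF w Axiom[OF A5_right] m]) (use params_mem[OF m] in simp)
  qed
  then show ?thesis using assms(2) unfolding evid_def ren_term.simps by blast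
qed

text \<open>Restricting \<open>f\<close> to the free variables of \<open>A\<close> and then
  extending it to \<open>g\<close> restricted to \<open>X\<close> makes the domain exactly
  \<open>X\<close>. So \<open>t:A\<close> with index set \<open>X\<close>, valued by
  \<open>g\<close>, lies in \<open>w\<close>, and (A6) applies.\<close>

lemma evid_bang:
  assumes w: "world w" and ev: "evid t A f w" and g: "f \<subseteq>\<^sub>m g" "ran g \<subseteq> params w"
    and X: "dom f \<inter> FV A \<subseteq> fset X" "fset X \<subseteq> dom g"
  shows "evid (Bang t) (Just t X A) g w"
proof -
  let ?f = "f |` FV A" and ?g = "g |` fset X"
  have "?f \<subseteq>\<^sub>m ?g"
    using g(1) X by (auto simp: map_le_def restrict_map_def)
  moreover have ran: "ran ?g \<subseteq> params w"
    using g(2) by (auto simp: ran_def restrict_map_def)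
  ultimately have "evid t A ?g w" by (rule evid_extend[OF w evid_restrict[OF ev]])
  then have "emb (val ?g) (Just t X A) \<in> w"
    by (subst (asm) evid_val[OF w ran, of X]) (use X in auto)
  moreover have "emb (val ?g) (Just t X A) = emb (val g) (Just t X A)"
    by (rule ren_cong) (simp add: val_def)
  ultimately have mem: "emb (val g) (Just t X A) \<in> w" by simp
  have eq: "emb (val g) (Just (Bang t) X (Just t X A))
      = Just (Bang (ren_term dbl t)) (val g |`| X) (emb (val g) (Just t X A))"
  proof -
    have "emb (\<lambda>x. if x |\<in>| X then val g x else dbl x) (Just t X A) = emb (val g) (Just t X A)"
      by (rule ren_cong) simp
    then show ?thesis unfolding ren.simps(10)[of dbl "val g" "Bang t"] ren_term.simps by (rule arg_cong)
  qed
  have "emb (val g) (Just (Bang t) X (Just t X A)) \<in> w"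
    unfolding eq using mem unfolding ren.simps
    by (rule world_imp[OF w Axiom[OF A6]]) (use params_mem[OF mem] in simp)
  then show ?thesis by (subst evid_val[OF w g(2), of X]) (use X in auto)
qed

text \<open>The index set \<open>Y\<close> consists of odd parameters, so the even
  \<open>dbl x\<close> meets the side condition of (A7). By hypothesis \<open>x\<close> is unvalued
  or not free in \<open>A\<close>, so binding it does not alter the embedded body.\<close>

lemma evid_gen:
  assumes w: "world w" and ev: "evid t A f w" and x: "x \<notin> dom f \<inter> FV A"
  shows "evid (Gen x t) (All x A) f w"
proof -
  obtain Y where Y: "fset Y = val f ` (FV A \<inter> dom f)"
    and mem: "Just (ren_term dbl t) Y (emb (val f) A) \<in> w"
    and ran: "ran f \<subseteq> params w"
    using ev unfolding evid_def by blast
  have FV: "fset Y \<subseteq> params w" using params_mem[OF mem] by simp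
  have "dbl x |\<notin>| Y"
    using FV world_odd[OF w, of "dbl x"] by (auto simp: dbl_def)
  then have "Just (Gen (dbl x) (ren_term dbl t)) Y (All (dbl x) (emb (val f) A)) \<in> w"
    by (intro world_imp[OF w Axiom[OF A7] mem]) (use FV in simp_all)
  moreover have "emb ((val f)(x := dbl x)) A = emb (val f) A"
  proof (rule ren_cong)
    fix z assume "z \<in> FV A"
    then have "z = x \<Longrightarrow> z \<notin> dom f" using x by blast
    then show "((val f)(x := dbl x)) z = val f z" by (simp add: val_None)
  qed
  moreover have "FV (All x A) \<inter> dom f = FV A \<inter> dom f" using x by auto
  ultimately show ?thesis using Y ran unfolding evid_def by auto
qed

text \<open>Both sides ask for the same formula in \<open>w\<close>, the substitution being absorbed
  into the valuation. Where \<open>f\<close> is undefined at \<open>\<sigma> x\<close>, the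
  definedness hypothesis forces \<open>\<sigma> x = x\<close>, and the even defaults agree.\<close>

lemma evid_subst:
  assumes ff: "free_for \<sigma> A" and dom: "\<sigma> ` {x. \<sigma> x \<noteq> x} \<subseteq> dom f"
  shows "evid t (subst \<sigma> A) (f |` FV (subst \<sigma> A)) w \<longleftrightarrow> evid t A ((f \<circ> \<sigma>) |` FV A) w"
proof -
  let ?f = "f |` FV (subst \<sigma> A)" and ?g = "(f \<circ> \<sigma>) |` FV A"
  have FV: "FV (subst \<sigma> A) = \<sigma> ` FV A" by (rule FV_subst[OF ff])
  have val_eq: "val ?f (\<sigma> x) = val ?g x" if "x \<in> FV A" for x
  proof (cases "\<sigma> x \<in> dom f")
    case True
    then show ?thesis using that FV by (auto simp: val_def)
  next
    case False
    then have "\<sigma> x = x" using dom by blast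
    then have "x \<in> FV (subst \<sigma> A)" using that FV by force
    then show ?thesis using that \<open>\<sigma> x = x\<close> by (simp add: val_def)
  qed
  have body: "emb (val ?f) (subst \<sigma> A) = emb (val ?g) A"
    unfolding ren_subst[OF ff] by (rule ren_cong) (rule val_eq)
  have "FV (subst \<sigma> A) \<inter> dom ?f = \<sigma> ` (FV A \<inter> dom ?g)"
    unfolding FV by (auto simp: dom_def restrict_map_def)
  then have "val ?f ` (FV (subst \<sigma> A) \<inter> dom ?f) = (\<lambda>x. val ?f (\<sigma> x)) ` (FV A \<inter> dom ?g)"
    by (simp add: image_image)
  also have "\<dots> = val ?g ` (FV A \<inter> dom ?g)"
    by (rule image_cong[OF refl]) (rule val_eq[OF IntD1])
  finally have "val ?f ` (FV (subst \<sigma> A) \<inter> dom ?f) = val ?g ` (FV A \<inter> dom ?g)" .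
  moreover have "ran ?f = ran ?g"
    unfolding FV by (auto simp: ran_def restrict_map_def split: if_splits)
  ultimately show ?thesis unfolding evid_def body by simp
qed

section \<open>The model and its truth lemma\<close>

definition canon :: "(nat set, nat) fmodel" where
  "canon = \<lparr>
     Worlds = {s. world (decode s)},
     Acc = {(s, s'). world (decode s) \<and> world (decode s') \<and> acc (decode s) (decode s')},
     Dm = (\<lambda>s. params (decode s)),
     Intp = (\<lambda>P n s. {ds. length ds = n \<and> Atom P ds \<in> decode s}),
     Evid = (\<lambda>t A f. {s. world (decode s) \<and> evid t A f (decode s)})\<rparr>"

lemma canon_simps [simp]:
  "s \<in> Worlds canon \<longleftrightarrow> world (decode s)"
  "(s, s') \<in> Acc canon \<longleftrightarrow> world (decode s) \<and> world (decode s') \<and> acc (decode s) (decode s')"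
  "Dm canon s = params (decode s)"
  "ds \<in> Intp canon P n s \<longleftrightarrow> length ds = n \<and> Atom P ds \<in> decode s"
  "s \<in> Evid canon t A f \<longleftrightarrow> world (decode s) \<and> evid t A f (decode s)"
  by (simp_all add: canon_def)

lemma frame_cond_canon:
  assumes "world w"
  shows "frame_cond canon"
proof -
  have "to_nat ` w \<in> Worlds canon" using assms by (simp add: decode_image)
  then have "Worlds canon \<noteq> {}" by blast
  moreover have "Acc canon \<subseteq> Worlds canon \<times> Worlds canon" by auto
  moreover have "refl_on (Worlds canon) (Acc canon)" by (auto simp: refl_on_def acc_refl)
  moreover have "trans (Acc canon)" by (auto simp: trans_def intro: acc_trans)
  moreover have "\<forall>s\<in>Worlds canon. Dm canon s \<noteq> {}" by (simp add: world_def)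
  moreover have "\<forall>s s'. (s, s') \<in> Acc canon \<longrightarrow> Dm canon s \<subseteq> Dm canon s'"
    by (simp add: acc_def)
  moreover have "Intp canon P n s \<subseteq> {ds. length ds = n \<and> set ds \<subseteq> Dm canon s}" for P n s
  proof
    fix ds assume "ds \<in> Intp canon P n s"
    then show "ds \<in> {ds. length ds = n \<and> set ds \<subseteq> Dm canon s}"
      using params_mem[of "Atom P ds" "decode s"] by simp
  qed
  ultimately show ?thesis unfolding frame_cond_def by blast
qed

lemma fitting_model_canon:
  assumes "world w"
  shows "fitting_model canon"
  unfolding fitting_model_def
proof (intro conjI)
  show "frame_cond canon" by (rule frame_cond_canon[OF assms])
  show "adequacy_cond canon" unfolding adequacy_cond_def by (auto simp: evid_def)
  show "substitution_cond canon"
    unfolding substitution_cond_def set_eq_iff by (auto simp: evid_subst)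
  show "R_closure_cond canon"
    unfolding R_closure_cond_def by (auto intro: evid_acc)
  show "extension_cond canon"
    unfolding extension_cond_def by (auto intro: evid_extend simp: ext_def fin_val_def)
  show "restriction_cond canon"
    unfolding restriction_cond_def by (auto intro: evid_restrict)
  show "app_cond canon" unfolding app_cond_def by (auto intro: evid_app)
  show "sum_cond canon" unfolding sum_cond_def by (auto intro: evid_sum)
  show "bang_cond canon"
    unfolding bang_cond_def by (auto intro: evid_bang simp: ext_def fin_val_def)
  show "gen_cond canon" unfolding gen_cond_def by (auto intro: evid_gen)
qed

text \<open>Stated apart because the truth clause of \<open>Just\<close> contains that of
  \<open>Box\<close>. Quantifying over decoded worlds loses nothing, since \<open>decode\<close> is
  onto.\<close>

lemma truth_Box:
  assumes IH: "\<And>\<nu> s. (\<And>x. odd (\<nu> x)) \<Longrightarrow> world (decode s) \<Longrightarrow>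
      sat canon \<nu> s A \<longleftrightarrow> emb \<nu> A \<in> decode s"
    and \<nu>: "\<And>x. odd (\<nu> x)" and s: "world (decode s)"
  shows "sat canon \<nu> s (Box X A) \<longleftrightarrow> emb \<nu> (Box X A) \<in> decode s"
proof -
  let ?V = "\<lambda>u. variants \<nu> (FV A - fset X) (params u)"
  have odd: "odd (\<mu> x)" if "world u" "\<mu> \<in> ?V u" for \<mu> u x
    using that \<nu> world_odd[OF that(1)] by (cases "x \<in> FV A - fset X") (auto simp: variants_def)
  have "sat canon \<mu> u A \<longleftrightarrow> emb \<mu> A \<in> decode u"
    if "world (decode u)" "\<mu> \<in> ?V (decode u)" for u \<mu>
    by (rule IH[OF odd[OF that] that(1)])
  then have "sat canon \<nu> s (Box X A) \<longleftrightarrow> \<nu> ` fset X \<subseteq> params (decode s) \<and>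
      (\<forall>u. world (decode u) \<and> acc (decode s) (decode u) \<longrightarrow>
        (\<forall>\<mu>\<in>?V (decode u). emb \<mu> A \<in> decode u))"
    using s by auto
  also have "\<dots> \<longleftrightarrow> \<nu> ` fset X \<subseteq> params (decode s) \<and>
      (\<forall>u. world u \<and> acc (decode s) u \<longrightarrow> (\<forall>\<mu>\<in>?V u. emb \<mu> A \<in> u))"
    by (metis decode_image)
  also have "\<dots> \<longleftrightarrow> emb \<nu> (Box X A) \<in> decode s"
    by (rule world_Box[OF s cf_odd[OF \<nu>], symmetric])
  finally show ?thesis .
qed

text \<open>Values need only be odd, which makes the embedding capture-free; they need not lie in
  the domain at \<open>s\<close>. If a free variable takes a value outside that domain, both sides
  fail.\<close>

lemma truth:
  assumes "\<And>x. odd (\<nu> x)" "world (decode s)"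
  shows "sat canon \<nu> s A \<longleftrightarrow> emb \<nu> A \<in> decode s"
  using assms
proof (induction A arbitrary: \<nu> s)
  case (Atom P xs)
  then show ?case by simp
next
  case (Neg A)
  have cf: "cf \<nu>" by (rule cf_odd[OF Neg.prems(1)])
  show ?case
    using Neg world_Neg[OF Neg.prems(2)] params_mem[of "emb \<nu> (Neg A)" "decode s"]
    by (auto simp: FV_emb[OF cf])
next
  case (Conj A B)
  then show ?case using world_Conj by simp
next
  case (Disj A B)
  have cf: "cf \<nu>" by (rule cf_odd[OF Disj.prems(1)])
  show ?case
    using Disj world_connectives(1)[OF Disj.prems(2), of "emb \<nu> A" "emb \<nu> B"]
      params_mem[of "emb \<nu> (Disj A B)" "decode s"]
    by (auto simp: FV_emb[OF cf] image_Un)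
next
  case (Imp A B)
  have cf: "cf \<nu>" by (rule cf_odd[OF Imp.prems(1)])
  show ?case
    using Imp world_connectives(2)[OF Imp.prems(2), of "emb \<nu> A" "emb \<nu> B"]
      params_mem[of "emb \<nu> (Imp A B)" "decode s"]
    by (auto simp: FV_emb[OF cf] image_Un)
next
  case (Iff A B)
  have cf: "cf \<nu>" by (rule cf_odd[OF Iff.prems(1)])
  show ?case
    using Iff world_connectives(3)[OF Iff.prems(2), of "emb \<nu> A" "emb \<nu> B"]
      params_mem[of "emb \<nu> (Iff A B)" "decode s"]
    by (auto simp: FV_emb[OF cf] image_Un)
next
  case (All x A)
  have IH: "sat canon (\<nu>(x := a)) s A \<longleftrightarrow> emb (\<nu>(x := a)) A \<in> decode s"
    if "a \<in> params (decode s)" for a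
    by (rule All.IH) (use All.prems world_odd that in auto)
  show ?case
    unfolding world_All[OF All.prems(2) cf_odd[OF All.prems(1)]] by (simp add: IH)
next
  case (Ex x A)
  have cf: "cf \<nu>" by (rule cf_odd[OF Ex.prems(1)])
  have IH: "sat canon (\<nu>(x := a)) s A \<longleftrightarrow> emb (\<nu>(x := a)) A \<in> decode s"
    if "a \<in> params (decode s)" for a
    by (rule Ex.IH) (use Ex.prems world_odd that in auto)
  have "sat canon \<nu> s (Ex x A) \<longleftrightarrow> \<nu> ` (FV A - {x}) \<subseteq> params (decode s) \<and>
      (\<exists>a\<in>params (decode s). emb (\<nu>(x := a)) A \<in> decode s)"
    by (simp add: IH)
  also have "\<dots> \<longleftrightarrow> emb \<nu> (Ex x A) \<in> decode s"
    using world_Ex[OF Ex.prems(2) cf] params_mem[of "emb \<nu> (Ex x A)" "decode s"] FV_emb[OF cf, of "Ex x A"]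
    by (metis FV.simps(8))
  finally show ?case .
next
  case (Box X A)
  show ?case by (rule truth_Box[OF Box.IH Box.prems])
next
  case (Just t X A)
  have cf: "cf \<nu>" by (rule cf_odd[OF Just.prems(1)])
  let ?f = "(Some \<circ> \<nu>) |` (FV A \<inter> fset X)"
  have box: "sat canon \<nu> s (Box X A) \<longleftrightarrow> emb \<nu> (Box X A) \<in> decode s"
    by (rule truth_Box[OF Just.IH Just.prems])
  have ev: "evid t A ?f (decode s) \<longleftrightarrow> emb \<nu> (Just t X A) \<in> decode s"
    if "\<nu> ` fset X \<subseteq> params (decode s)"
    by (rule evid_iff[OF Just.prems(2) cf _ _ that])
      (use that in \<open>auto simp: ran_def restrict_map_def split: if_splits\<close>)
  have FV: "\<nu> ` fset X \<subseteq> params (decode s)" if "emb \<nu> (Just t X A) \<in> decode s"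
    using params_mem[OF that] unfolding FV_emb[OF cf] by simp
  have "emb \<nu> (Box X A) \<in> decode s" if "emb \<nu> (Just t X A) \<in> decode s"
    by (rule world_imp[OF Just.prems(2) _ that]) (use Axiom[OF A8] FV[OF that] in simp_all)
  moreover have "\<nu> ` fset X \<subseteq> params (decode s)" if "emb \<nu> (Box X A) \<in> decode s"
    using params_mem[OF that] unfolding FV_emb[OF cf] by simp
  moreover have "sat canon \<nu> s (Just t X A) \<longleftrightarrow>
      sat canon \<nu> s (Box X A) \<and> evid t A ?f (decode s)"
    using Just.prems(2) by simp
  ultimately show ?case using box ev by blast
qed

text \<open>\<open>CS'\<close> is the original specification and \<open>CS\<close> the embedded one.
  At the empty valuation every variable of \<open>A\<close> defaults to its even copy, so the
  evidence is the embedded member of \<open>CS'\<close>, a theorem.\<close>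

lemma meets_canon:
  assumes "\<And>c A. Just (JConst c) {||} A \<in> CS' \<Longrightarrow> ren dbl dbl (Just (JConst c) {||} A) \<in> CS"
  shows "meets canon CS'"
  unfolding meets_def
proof (intro allI impI set_eqI iffI)
  fix c A s assume mem: "Just (JConst c) {||} A \<in> CS'" and "s \<in> Worlds canon"
  then have w: "world (decode s)" by simp
  have val: "val Map.empty = dbl" by (auto simp: val_def)
  have "ren dbl dbl (Just (JConst c) {||} A) \<in> decode s"
    by (rule world_closed[OF w entails_Th[OF ConstSpec[OF assms[OF mem]]]]) simp
  then show "s \<in> Evid canon (JConst c) A Map.empty"
    using w by (auto simp: evid_def val)
qed simp

lemma ex_world_refuting:
  assumes "\<not> entails S A" "\<forall>B\<in>S. FV B = {}" "FV A = {}"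
  shows "\<exists>w. world w \<and> S \<subseteq> w \<and> A \<notin> w"
proof -
  have "cons (insert (Neg A) S)"
  proof (rule ccontr)
    assume "\<not> ?thesis"
    then have "entails S (Neg (Neg A))" by (rule not_cons_insert)
    then show False using assms(1) entails_taut[of "[Neg (Neg A)]" S A] by simp
  qed
  moreover have "infinite {v :: var. odd v}"
  proof -
    have "inj (\<lambda>n :: nat. Suc (2 * n))" by (auto simp: inj_def)
    then have "infinite (range (\<lambda>n :: nat. Suc (2 * n)))" by (rule range_inj_infinite)
    moreover have "range (\<lambda>n :: nat. Suc (2 * n)) \<subseteq> {v. odd v}" by auto
    ultimately show ?thesis using finite_subset by blast
  qed
  ultimately obtain w where "world w" "insert (Neg A) S \<subseteq> w"
    using ex_world[of "insert (Neg A) S" "{}"] assms(2,3) by auto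
  then show ?thesis using world_Neg assms(3) by (metis empty_subsetI insert_subset)
qed

end

section \<open>Transfer to derivations from closed hypotheses\<close>

text \<open>Closed hypotheses block no generalization, so every step of the derivation stays
  legal.\<close>

lemma derives_closed_hyps:
  assumes "derives CS {} A" "\<forall>B\<in>\<Gamma>. closed_fm B"
  shows "derives CS \<Gamma> A"
  using assms(1)
proof induction
  case (MP A B)
  then show ?case by (blast intro: derives.MP)
next
  case (Generalization A x)
  then show ?case using assms(2) by (intro derives.Generalization) (auto simp: closed_fm_def)
qed (auto intro: derives.intros)

lemma derives_imps: "derives CS \<Gamma> (imps L A) \<Longrightarrow> set L \<subseteq> \<Gamma> \<Longrightarrow> derives CS \<Gamma> A"
  by (induction L) (auto dest: MP[OF _ Hyp])

lemma ren_imps: "ren \<rho> \<sigma> (imps L A) = imps (map (ren \<rho> \<sigma>) L) (ren \<rho> \<sigma> A)"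
  by (induction L) simp_all

theorem mainTheorem2:
  fixes CS \<Gamma> :: "fm set" and \<Phi> :: fm
  assumes "const_spec CS"
    and "\<forall>\<Psi>\<in>\<Gamma>. closed_fm \<Psi>"
    and "closed_fm \<Phi>"
    and "\<not> derives CS \<Gamma> \<Phi>"
  shows "\<exists>(M :: (nat set, nat) fmodel) \<nu> w.
           fitting_model M \<and> meets M CS \<and> valuation M \<nu> \<and> w \<in> Worlds M \<and>
           (\<forall>\<Psi>\<in>\<Gamma>. sat M \<nu> w \<Psi>) \<and> \<not> sat M \<nu> w \<Phi>"
proof -
  interpret folp "ren dbl dbl ` CS"
    by standard (rule const_spec_ren_dbl[OF assms(1)])
  have closed: "FV (ren dbl dbl A) = {}" if "closed_fm A" for A
    using that FV_emb[OF capture_free_inj[OF inj_dbl], of A] by (simp add: closed_fm_def)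
  have "\<not> entails (ren dbl dbl ` \<Gamma>) (ren dbl dbl \<Phi>)"
  proof
    assume "entails (ren dbl dbl ` \<Gamma>) (ren dbl dbl \<Phi>)"
    then obtain K where K: "set K \<subseteq> ren dbl dbl ` \<Gamma>" "Th (imps K (ren dbl dbl \<Phi>))"
      unfolding entails_def by blast
    from K(1) have "K \<in> lists (ren dbl dbl ` \<Gamma>)" by auto
    then obtain L where L: "K = map (ren dbl dbl) L" "set L \<subseteq> \<Gamma>"
      unfolding lists_image by auto
    have "derives CS {} (imps L \<Phi>)"
      using K(2) unfolding L(1) ren_imps[symmetric] by (rule derives_ren_dblD)
    then have "derives CS \<Gamma> \<Phi>"
      using derives_imps[OF derives_closed_hyps[OF _ assms(2)] L(2)] by blast
    then show False using assms(4) by contradiction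
  qed
  then obtain w where w: "world w" "ren dbl dbl ` \<Gamma> \<subseteq> w" "ren dbl dbl \<Phi> \<notin> w"
    using ex_world_refuting[of "ren dbl dbl ` \<Gamma>" "ren dbl dbl \<Phi>"] closed assms(2,3) by auto
  obtain a where a: "a \<in> params w" using w(1) unfolding world_def by blast
  \<comment> \<open>Closed formulas ignore the valuation, so one constant parameter will do; it is
    odd, as the truth lemma demands.\<close>
  let ?w = "to_nat ` w" and ?\<nu> = "\<lambda>_ :: var. a"
  have W: "world (decode ?w)" using w(1) by (simp add: decode_image)
  have sat: "sat canon ?\<nu> ?w A \<longleftrightarrow> ren dbl dbl A \<in> w" if "closed_fm A" for A
  proof -
    have "emb ?\<nu> A = emb dbl A"
      by (rule ren_cong) (use that in \<open>simp add: closed_fm_def\<close>)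
    then show ?thesis
      using truth[of ?\<nu>, OF world_odd[OF w(1) a] W, of A] by (simp add: decode_image)
  qed
  have "fitting_model canon" by (rule fitting_model_canon[OF w(1)])
  moreover have "meets canon CS" by (rule meets_canon) (rule imageI)
  moreover have "valuation canon ?\<nu>"
  proof -
    have "?w \<in> Worlds canon" "a \<in> Dm canon ?w" using W a by (simp_all add: decode_image)
    then show ?thesis unfolding valuation_def Domain_of_def by blast
  qed
  moreover have "?w \<in> Worlds canon" using W by simp
  moreover have "\<forall>\<Psi>\<in>\<Gamma>. sat canon ?\<nu> ?w \<Psi>" using sat assms(2) w(2) by blast
  moreover have "\<not> sat canon ?\<nu> ?w \<Phi>" using sat assms(3) w(3) by blast
  ultimately show ?thesis by blast
qed

end
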